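(* Consider logistic regression with random design: $X_i=(Y_i,Z_i)\in\{-1,1\}\times\mathbb{R}^d$, $i=1,\dots,n$, are i.i.d., with $$\mathbb{P}\{Y_i=y\mid Z_i=z,\theta\}=\frac{e^{y z^t\theta}}{1+e^{y z^t\theta}},\qquad \theta\in\Theta=\mathbb{R}^d,$$ where the distribution of the $Z_i$ does not depend on $\theta$, and the true parameter is $\theta_0\in\mathbb{R}^d$. Let the prior be $\pi=\mathcal{N}(0,\vartheta^2I_d)$ with $\vartheta>0$. Let $\mathcal{F}\subset\mathcal{M}_1^+(\mathbb{R}^d)$ be any family containing $\mathcal{F}^\Phi_{id}=\{\mathcal{N}(m,\sigma^2I_d): m\in\mathbb{R}^d,\sigma^2>0\}$, and let $\tilde\pi_{n,\alpha}(\cdot|X_1^n)$ be the variational approximation in $\mathcal{F}$ of the tempered posterior. Assume that $K_1:=2\mathbb{E}\|Z_1\|<\infty$ and $K_2:=4\mathbb{E}\|Z_1\|^2<\infty$. Put $$\varepsilon_n=\frac{K_1}{n}\vee \frac{K_2}{n^2} \vee \left\lbrace\frac{d}{n} \left[ \frac12 \log\left(\vartheta^2 n^2 \sqrt{d}\right) + \frac{1}{n\vartheta^2} \right] + \frac{\|\theta_0\|^2}{n\vartheta^2} - \frac{d}{2n}\right\rbrace .$$ Then for any $\alpha\in(0,1)$ and any $\eta,\varepsilon\in(0,1)$, $$\mathbb{P}\left[ \int D_{\alpha}(P_{\theta},P_{\theta_0})\, \tilde{\pi}_{n,\alpha}(\mathrm{d}\theta|X_1^n) \leq \frac{(\alpha+1)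 \varepsilon_n + \alpha \sqrt{\frac{\varepsilon_n}{n\eta}} + \frac{\log\left(\frac{1}{\varepsilon}\right)}{n}}{1-\alpha}\right]\geq 1-\varepsilon-\eta .$$
   Context: $P_\theta$ is the joint law of $X_1=(Y_1,Z_1)$ under parameter $\theta$, with density $p_\theta$ with respect to a common dominating measure. $\mathcal{M}_1^+(\mathbb{R}^d)$ is the set of Borel probability measures on $\mathbb{R}^d$. $\mathbb{P}=P_{\theta_0}^{\otimes n}$ is the law of $X_1^n=(X_1,\dots,X_n)$ and $\mathbb{E}$ the corresponding expectation. $a\vee b=\max(a,b)$; $\|\cdot\|$ is the Euclidean norm. $r_n(\theta,\theta')=\sum_{i=1}^n\log\frac{p_{\theta'}(X_i)}{p_\theta(X_i)}$. $D_\alpha(P,R)=\frac{1}{\alpha-1}\log\int\left(\frac{\mathrm{d}P}{\mathrm{d}\mu}\right)^\alpha\left(\frac{\mathrm{d}R}{\mathrm{d}\mu}\right)^{1-\alpha}\mathrm{d}\mu$ for any $\mu$ dominating $P,R$. $\mathcal{K}(P,R)=\int\log\frac{\mathrm{d}P}{\mathrm{d}R}\,\mathrm{d}P$ if $P\ll R$, $+\infty$ otherwise. Tempered posterior: $\pi_{n,\alpha}(\mathrm{d}\theta|X_1^n)\propto e^{-\alpha r_n(\theta,\theta_0)}\pi(\mathrm{d}\theta)\propto\left(\prod_i p_\theta(X_i)\right)^\alpha\pi(\mathrm{d}\theta)$. Variational approximation: $\tilde\pi_{n,\alpha}(\cdot|X_1^n)=\arg\min_{\rho\in\mathcal{F}}\mathcal{K}(\rho,\pi_{n,\alpha}(\cdot|X_1^n))$,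 equivalently $\tilde\pi_{n,\alpha}(\cdot|X_1^n)=\arg\min_{\rho\in\mathcal{F}}\left\{\alpha\int r_n(\theta,\theta_0)\rho(\mathrm{d}\theta)+\mathcal{K}(\rho,\pi)\right\}$ (a minimizer is assumed to exist). *)

theory Defs
  imports "HOL-Probability.Probability"
begin

section \<open>Divergences\<close>

text \<open>
  \<open>KL P R\<close> is the extended-real Kullback--Leibler divergence of \<open>P\<close> from \<open>R\<close>.  The argument order of
  the library's \<open>KL_divergence b R P\<close> is reversed, and it is a Bochner integral, hence \<open>0\<close> when the
  log-ratio is not integrable.  For probability measures the negative part of the log-ratio is always
  \<open>P\<close>-integrable, so that a non-integrable log-ratio means that the divergence is \<open>\<infinity>\<close>.
\<close>

definition KL :: "'a measure \<Rightarrow> 'a measure \<Rightarrow> ereal" where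
  "KL P R =
     (if absolutely_continuous R P \<and> integrable P (entropy_density (exp 1) R P)
      then ereal (KL_divergence (exp 1) R P) else \<infinity>)"

definition hellinger_integral ::
    "real \<Rightarrow> 'a measure \<Rightarrow> 'a measure \<Rightarrow> 'a measure \<Rightarrow> ennreal" where
  "hellinger_integral \<alpha> \<mu> P R =
     (\<integral>\<^sup>+x. ennreal (enn2real (RN_deriv \<mu> P x) powr \<alpha> * enn2real (RN_deriv \<mu> R x) powr (1 - \<alpha>)) \<partial>\<mu>)"

text \<open>
  The Renyi divergence of order \<open>\<alpha> \<in> (0, 1)\<close>.  The dominating measure is the supremum of \<open>P\<close> and \<open>R\<close>;
  any other one gives the same value, see \<open>renyi_div_eq\<close> below.  For probability measures the integral
  is at most \<open>1\<close>, so the value is a nonnegative number; it is \<open>\<infinity>\<close> if \<open>P\<close> and \<open>R\<close> are mutually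
  singular.
\<close>

definition renyi_value :: "real \<Rightarrow> ennreal \<Rightarrow> ennreal" where
  "renyi_value \<alpha> I = (if I = 0 then \<infinity> else ennreal (1 / (\<alpha> - 1) * ln (enn2real I)))"

definition renyi_div :: "real \<Rightarrow> 'a measure \<Rightarrow> 'a measure \<Rightarrow> ennreal" where
  "renyi_div \<alpha> P R = renyi_value \<alpha> (hellinger_integral \<alpha> (sup P R) P R)"

lemma hellinger_integral_change:
  assumes "sigma_finite_measure \<mu>" "sigma_finite_measure S" "finite_measure P" "finite_measure R"
    and sets: "sets S = sets \<mu>" "sets P = sets \<mu>" "sets R = sets \<mu>"
    and ac: "absolutely_continuous \<mu> S" "absolutely_continuous S P" "absolutely_continuous S R"
  shows "hellinger_integral \<alpha> S P R = hellinger_integral \<alpha> \<mu> P R"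
proof -
  interpret \<mu>: sigma_finite_measure \<mu> by fact
  interpret S: sigma_finite_measure S by fact
  interpret P: finite_measure P by fact
  interpret R: finite_measure R by fact
  define s where "s = RN_deriv \<mu> S"
  define p where "p = RN_deriv S P"
  define r where "r = RN_deriv S R"
  have [measurable]: "s \<in> borel_measurable \<mu>" "p \<in> borel_measurable S" "r \<in> borel_measurable S"
    by (auto simp: s_def p_def r_def)
  have [measurable]: "p \<in> borel_measurable \<mu>" "r \<in> borel_measurable \<mu>"
    using \<open>p \<in> borel_measurable S\<close> \<open>r \<in> borel_measurable S\<close>
    unfolding measurable_cong_sets[OF sets(1) refl] .
  have S: "density \<mu> s = S"
    unfolding s_def by (rule \<mu>.density_RN_deriv) (use ac sets in auto)
  have dP: "density S p = P" and dR: "density S r = R"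
    unfolding p_def r_def by (rule S.density_RN_deriv; use ac sets in auto)+
  have "density \<mu> (\<lambda>x. s x * p x) = density S p" "density \<mu> (\<lambda>x. s x * r x) = density S r"
    by (subst S[symmetric], subst density_density_eq; simp)+
  then have "AE x in \<mu>. s x * p x = RN_deriv \<mu> P x" "AE x in \<mu>. s x * r x = RN_deriv \<mu> R x"
    by (intro \<mu>.RN_deriv_unique; simp add: dP dR)+
  moreover have "AE x in \<mu>. s x \<noteq> \<infinity>"
    unfolding s_def using assms by (intro \<mu>.RN_deriv_finite) auto
  ultimately have *: "AE x in \<mu>.
      s x * ennreal (enn2real (p x) powr \<alpha> * enn2real (r x) powr (1 - \<alpha>)) =
      ennreal (enn2real (RN_deriv \<mu> P x) powr \<alpha> * enn2real (RN_deriv \<mu> R x) powr (1 - \<alpha>))"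
  proof eventually_elim
    case (elim x)
    obtain t where t: "s x = ennreal t" "0 \<le> t"
      using elim(3) by (cases "s x") auto
    have "t * (enn2real (p x) powr \<alpha> * enn2real (r x) powr (1 - \<alpha>)) =
        (t * enn2real (p x)) powr \<alpha> * (t * enn2real (r x)) powr (1 - \<alpha>)"
      using t(2) powr_add[of t \<alpha> "1 - \<alpha>"] by (cases "t = 0") (auto simp: powr_mult)
    then show ?case
      unfolding elim(1,2)[symmetric] t(1) using t(2)
      by (simp add: enn2real_mult ennreal_mult'[symmetric])
  qed
  have "hellinger_integral \<alpha> S P R =
      (\<integral>\<^sup>+x. ennreal (enn2real (p x) powr \<alpha> * enn2real (r x) powr (1 - \<alpha>)) \<partial>density \<mu> s)"
    by (simp add: hellinger_integral_def S p_def r_def)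
  also have "\<dots> = (\<integral>\<^sup>+x. s x * ennreal (enn2real (p x) powr \<alpha> * enn2real (r x) powr (1 - \<alpha>)) \<partial>\<mu>)"
    by (subst nn_integral_density) auto
  also have "\<dots> = hellinger_integral \<alpha> \<mu> P R"
    unfolding hellinger_integral_def by (rule nn_integral_cong_AE) (use * in auto)
  finally show ?thesis .
qed

lemma renyi_div_eq:
  assumes "sigma_finite_measure \<mu>" "finite_measure P" "finite_measure R"
    and sets: "sets P = sets \<mu>" "sets R = sets \<mu>"
    and ac: "absolutely_continuous \<mu> P" "absolutely_continuous \<mu> R"
  shows "renyi_div \<alpha> P R = renyi_value \<alpha> (hellinger_integral \<alpha> \<mu> P R)"
proof -
  interpret P: finite_measure P by fact
  interpret R: finite_measure R by fact
  have sup: "sup P R = sup_measure' P R"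
    using sets sets_eq_imp_space_eq[of P R] by (simp add: sup_measure_def sup_lexord_def)
  have sets': "sets (sup P R) = sets \<mu>"
    using sets by (simp add: sup)
  have sp: "space P = space R" "space (sup P R) = space P"
    by (rule sets_eq_imp_space_eq; simp add: sets sets')+
  have em: "emeasure (sup P R) X = (SUP Y\<in>sets P. emeasure P (X \<inter> Y) + emeasure R (X \<inter> - Y))"
    if "X \<in> sets P" for X
    using sets that by (simp add: sup emeasure_sup_measure')
  have bound: "emeasure (sup P R) X \<le> emeasure P X + emeasure R X" if "X \<in> sets P" for X
    unfolding em[OF that] using that sets
    by (intro SUP_least add_mono emeasure_mono) auto
  have leP: "emeasure P X \<le> emeasure (sup P R) X" if "X \<in> sets P" for X
    unfolding em[OF that] using that
    by (intro SUP_upper2[of X]) auto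
  have leR: "emeasure R X \<le> emeasure (sup P R) X" if "X \<in> sets P" for X
    unfolding em[OF that]
    by (intro SUP_upper2[of "{}"]) auto
  have "emeasure (sup P R) (space P) < \<infinity>"
    using bound[of "space P"] P.emeasure_finite R.emeasure_finite
    by (metis ennreal_add_eq_top infinity_ennreal_def order_le_less_trans sets.top top.not_eq_extremum)
  then interpret S: finite_measure "sup P R"
    by (intro finite_measureI) (simp add: sp)
  have "absolutely_continuous \<mu> (sup P R)"
    unfolding absolutely_continuous_def
  proof
    fix N assume N: "N \<in> null_sets \<mu>"
    then have "N \<in> null_sets P" "N \<in> null_sets R"
      using ac by (auto simp: absolutely_continuous_def)
    then show "N \<in> null_sets (sup P R)"
      using bound[of N] sets sets' by (auto simp: null_sets_def)
  qed
  moreover have "absolutely_continuous (sup P R) P" "absolutely_continuous (sup P R) R"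
    using leP leR sets sets' by (fastforce simp: absolutely_continuous_def null_sets_def)+
  ultimately have "hellinger_integral \<alpha> (sup P R) P R = hellinger_integral \<alpha> \<mu> P R"
    using assms sets' S.sigma_finite_measure_axioms by (intro hellinger_integral_change) auto
  then show ?thesis
    by (simp add: renyi_div_def)
qed


section \<open>Tempered posteriors\<close>

text \<open>
  A model is given by the densities \<open>p \<theta>\<close> of its laws with respect to a common dominating measure; a
  sample of size \<open>n\<close> is a function on \<open>{1..n}\<close>.
\<close>

definition log_ratio :: "('t \<Rightarrow> 'x \<Rightarrow> real) \<Rightarrow> nat \<Rightarrow> (nat \<Rightarrow> 'x) \<Rightarrow> 't \<Rightarrow> 't \<Rightarrow> real" where
  "log_ratio p n x \<theta> \<theta>' = (\<Sum>i=1..n. ln (p \<theta>' (x i) / p \<theta> (x i)))"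

definition tempered_posterior ::
    "('t \<Rightarrow> 'x \<Rightarrow> real) \<Rightarrow> 't measure \<Rightarrow> real \<Rightarrow> 't \<Rightarrow> nat \<Rightarrow> (nat \<Rightarrow> 'x) \<Rightarrow> 't measure" where
  "tempered_posterior p \<pi> \<alpha> \<theta>0 n x =
     density \<pi> (\<lambda>\<theta>. ennreal (exp (- \<alpha> * log_ratio p n x \<theta> \<theta>0)) /
                      (\<integral>\<^sup>+\<theta>'. ennreal (exp (- \<alpha> * log_ratio p n x \<theta>' \<theta>0)) \<partial>\<pi>))"


section \<open>Isotropic Gaussians\<close>

text \<open>The parameter \<open>\<sigma>\<close> is the standard deviation: the covariance matrix is \<open>\<sigma>\<^sup>2\<close> times the identity.\<close>

definition iso_gaussian :: "'a::euclidean_space \<Rightarrow> real \<Rightarrow> 'a measure" where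
  "iso_gaussian m \<sigma> =
     density lborel (\<lambda>x. ennreal (\<Prod>b\<in>Basis. normal_density (m \<bullet> b) \<sigma> (x \<bullet> b)))"


section \<open>Logistic regression with random design\<close>

text \<open>
  Observations are pairs \<open>(y, z)\<close> of a label in \<open>{-1, 1}\<close> and a design point whose law is \<open>Q\<close>.
  \<open>logistic_prob \<theta> (y, z)\<close> is the conditional probability of \<open>y\<close> given \<open>z\<close>, and also the density of the
  joint law with respect to the product of the counting measure and \<open>Q\<close>.
\<close>

definition logistic_prob :: "'a::euclidean_space \<Rightarrow> real \<times> 'a \<Rightarrow> real" where
  "logistic_prob \<theta> = (\<lambda>(y, z). exp (y * (z \<bullet> \<theta>)) / (1 + exp (y * (z \<bullet> \<theta>))))"

definition logistic_law :: "'a::euclidean_space measure \<Rightarrow> 'a \<Rightarrow> (real \<times> 'a) measure" where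
  "logistic_law Q \<theta> = density (count_space {-1, 1} \<Otimes>\<^sub>M Q) (\<lambda>x. ennreal (logistic_prob \<theta> x))"

lemma logistic_prob_measurable:
  assumes "sets Q = sets borel"
  shows "logistic_prob \<theta> \<in> borel_measurable (count_space {-1, 1} \<Otimes>\<^sub>M Q)"
proof -
  let ?M = "count_space {-1, 1::real} \<Otimes>\<^sub>M Q"
  have snd: "snd \<in> borel_measurable ?M"
    using measurable_snd[of "count_space {-1, 1::real}" Q]
    unfolding measurable_cong_sets[OF refl assms] .
  have fst: "fst \<in> borel_measurable ?M"
    by (rule measurable_compose[OF measurable_fst]) simp
  have "(\<lambda>x. fst x * (snd x \<bullet> \<theta>)) \<in> borel_measurable ?M"
    by (intro borel_measurable_times borel_measurable_inner fst snd borel_measurable_const)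
  then show ?thesis
    unfolding logistic_prob_def split_beta
    by (intro borel_measurable_divide borel_measurable_add borel_measurable_const
        measurable_compose[OF _ borel_measurable_exp]) auto
qed

lemma emeasure_logistic_law:
  assumes Q: "prob_space Q" "sets Q = sets borel" and y: "y \<in> {-1, 1}" and B: "B \<in> sets borel"
  shows "emeasure (logistic_law Q \<theta>) ({y} \<times> B) = (\<integral>\<^sup>+z\<in>B. ennreal (logistic_prob \<theta> (y, z)) \<partial>Q)"
proof -
  interpret Q: prob_space Q by fact
  interpret C: sigma_finite_measure "count_space {-1, 1::real}"
    by (rule sigma_finite_measure_count_space_finite) simp
  interpret pair_sigma_finite "count_space {-1, 1::real}" Q ..
  note [measurable] = logistic_prob_measurable[OF Q(2)]
  have [measurable]: "B \<in> sets Q" using B Q(2) by simp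
  have [measurable]: "{y} \<times> B \<in> sets (count_space {-1, 1} \<Otimes>\<^sub>M Q)"
    using y by (intro pair_measureI) auto
  have "emeasure (logistic_law Q \<theta>) ({y} \<times> B) =
      (\<integral>\<^sup>+x. ennreal (logistic_prob \<theta> x) * indicator ({y} \<times> B) x \<partial>(count_space {-1, 1} \<Otimes>\<^sub>M Q))"
    unfolding logistic_law_def by (subst emeasure_density) auto
  also have "\<dots> = (\<integral>\<^sup>+y'. \<integral>\<^sup>+z. ennreal (logistic_prob \<theta> (y', z)) * indicator ({y} \<times> B) (y', z) \<partial>Q
      \<partial>count_space {-1, 1})"
    by (subst Q.nn_integral_fst[symmetric]) auto
  also have "\<dots> = (\<integral>\<^sup>+z. ennreal (logistic_prob \<theta> (y, z)) * indicator B z \<partial>Q)"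
    using y by (auto simp: nn_integral_count_space_finite indicator_def)
  finally show ?thesis .
qed

lemma prob_space_logistic_law:
  assumes Q: "prob_space Q" "sets Q = sets borel"
  shows "prob_space (logistic_law Q \<theta>)"
proof
  interpret Q: prob_space Q by fact
  have spQ: "space Q = UNIV" using Q(2) sets_eq_imp_space_eq by fastforce
  have sets: "{y} \<times> UNIV \<in> sets (logistic_law Q \<theta>)" if "y \<in> {-1, 1}" for y
    using that Q(2) unfolding logistic_law_def sets_density by (intro pair_measureI) auto
  have [measurable]: "(\<lambda>z. logistic_prob \<theta> (y, z)) \<in> borel_measurable Q" for y
    unfolding measurable_cong_sets[OF Q(2) refl] by (simp add: logistic_prob_def)
  have sum1: "logistic_prob \<theta> (-1, z) + logistic_prob \<theta> (1, z) = 1" for z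
  proof -
    define e where "e = exp (z \<bullet> \<theta>)"
    have "e > 0" by (simp add: e_def)
    then have "inverse e / (1 + inverse e) = 1 / (1 + e)"
      by (simp add: divide_simps)
    moreover have "1 / (1 + e) + e / (1 + e) = 1"
      using \<open>e > 0\<close> by (simp add: add_divide_distrib[symmetric])
    ultimately show ?thesis
      by (simp add: logistic_prob_def exp_minus e_def)
  qed
  have nonneg: "0 \<le> logistic_prob \<theta> (y, z)" for y z
    by (auto simp: logistic_prob_def intro!: divide_nonneg_pos add_pos_pos)
  have "space (logistic_law Q \<theta>) = {-1} \<times> UNIV \<union> {1} \<times> UNIV"
    by (auto simp: logistic_law_def space_pair_measure spQ)
  then have "emeasure (logistic_law Q \<theta>) (space (logistic_law Q \<theta>)) =
      emeasure (logistic_law Q \<theta>) ({-1} \<times> UNIV) + emeasure (logistic_law Q \<theta>) ({1} \<times> UNIV)"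
    using sets[of 1] sets[of "-1"]
    by (subst plus_emeasure) auto
  also have "\<dots> = (\<integral>\<^sup>+z. ennreal (logistic_prob \<theta> (-1, z)) \<partial>Q) + (\<integral>\<^sup>+z. ennreal (logistic_prob \<theta> (1, z)) \<partial>Q)"
    using Q by (simp add: emeasure_logistic_law)
  also have "\<dots> = (\<integral>\<^sup>+z. ennreal (logistic_prob \<theta> (-1, z) + logistic_prob \<theta> (1, z)) \<partial>Q)"
    by (subst nn_integral_add[symmetric]) (auto simp: nonneg)
  also have "\<dots> = 1"
    by (simp add: sum1 Q.emeasure_space_1)
  finally show "emeasure (logistic_law Q \<theta>) (space (logistic_law Q \<theta>)) = 1" .
qed


section \<open>Inner probability\<close>

text \<open>
  A variational posterior is an arbitrary choice of minimizers, so events expressed through it need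
  not be measurable, and \<open>measure\<close> would assign \<open>0\<close> to a non-measurable set.  A lower bound on the
  inner probability is the same as a lower bound on the probability of some measurable subset; on
  measurable events, inner probability is probability.
\<close>

definition inner_prob :: "'a measure \<Rightarrow> 'a set \<Rightarrow> real" where
  "inner_prob M A = (SUP B\<in>{B \<in> sets M. B \<subseteq> A}. measure M B)"

lemma (in finite_measure) inner_prob_eq_measure:
  assumes "A \<in> sets M"
  shows "inner_prob M A = measure M A"
  unfolding inner_prob_def using assms
  by (intro cSup_eq_maximum) (auto intro!: finite_measure_mono)

end

theory Submission
  imports Defs
begin

text \<open>
  Let \<open>H \<theta>\<close> be the Hellinger integral of \<open>P\<^sub>\<theta>\<close> and the true law, so that
  \<open>exp (- \<alpha> r\<^sub>n(\<theta>, \<theta>0))\<close> has expectation \<open>H \<theta> ^ n\<close>.  By Fubini, \<open>exp (- n ln (H \<theta>) - \<alpha> r\<^sub>n(\<theta>, \<theta>0))\<close>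
  integrated against the prior has expectation \<open>1\<close>, and Markov's inequality bounds it by \<open>1 / \<epsilon>\<close>.  On that
  event the Donsker--Varadhan inequality relative to the tempered posterior controls \<open>- n ln (H \<theta>)\<close>, which is
  \<open>n (1 - \<alpha>)\<close> times the Renyi divergence, under any law by its divergence from the tempered posterior.
  For the variational posterior this divergence is at most that of \<open>N(\<theta>0, I / n\<^sup>2)\<close>.  The latter has a closed
  form, up to the average of the log-likelihood ratio, a sum of i.i.d. terms to which Chebyshev's inequality
  applies.  The terms are at most \<open>norm Z / n\<close>, as the log-likelihood is \<open>1\<close>-Lipschitz in \<open>Z \<bullet> \<theta>\<close>,
  whose standard deviation under that Gaussian is \<open>norm Z / n\<close>; averaging \<open>Z \<bullet> (\<theta> - \<theta>0)\<close> rather than \<open>norm (\<theta> - \<theta>0)\<close>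
  avoids a factor depending on the dimension.
\<close>

section \<open>Divergence through densities, under reweighting, and in variational form\<close>

section \<open>Kullback--Leibler divergence\<close>

lemma log_exp_1: "log (exp 1) x = ln x"
  by (simp add: log_def)

text \<open>Positivity of \<open>f\<close> makes the law with density \<open>g\<close> a reweighting
  by \<open>g / f\<close> of the law with density \<open>f\<close>, and uniqueness of the
  Radon-Nikodym derivative identifies the entropy density almost everywhere. Integrability of the
  log-ratio excludes the default \<open>\<infinity>\<close> of \<open>KL\<close>.\<close>

lemma KL_density_density:
  fixes f g :: "'a \<Rightarrow> real"
  assumes M: "sigma_finite_measure M"
    and f [measurable]: "f \<in> borel_measurable M" and g [measurable]: "g \<in> borel_measurable M"
    and f_pos: "\<And>x. x \<in> space M \<Longrightarrow> 0 < f x" and g_nonneg: "\<And>x. x \<in> space M \<Longrightarrow> 0 \<le> g x"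
    and int: "integrable (density M g) (\<lambda>x. ln (g x / f x))"
  shows "KL (density M g) (density M f) = ereal (\<integral>x. ln (g x / f x) \<partial>density M g)"
proof -
  let ?F = "density M f" and ?G = "density M g"
  interpret M: sigma_finite_measure M by fact
  interpret F: sigma_finite_measure ?F
    using f_pos by (subst M.sigma_finite_iff_density_finite) (auto intro: AE_I2)
  have G: "density ?F (\<lambda>x. g x / f x) = ?G"
    using f_pos g_nonneg by (intro density_density_divide) (auto simp: less_imp_le dest: f_pos intro!: AE_I2)
  have "AE x in ?F. ennreal (g x / f x) = RN_deriv ?F ?G x"
    by (rule F.RN_deriv_unique) (use G in auto)
  moreover have ac: "absolutely_continuous ?F ?G"
    unfolding G[symmetric] by (rule absolutely_continuousI_density) simp
  ultimately have "AE x in ?G. ennreal (g x / f x) = RN_deriv ?F ?G x"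
    by (intro absolutely_continuous_AE[OF _ ac]) auto
  then have ae: "AE x in ?G. entropy_density (exp 1) ?F ?G x = ln (g x / f x)"
    using AE_space
  proof eventually_elim
    case (elim x)
    have "entropy_density (exp 1) ?F ?G x = ln (enn2real (ennreal (g x / f x)))"
      unfolding elim(1) by (simp add: entropy_density_def log_exp_1)
    then show ?case
      using elim(2) f_pos[of x] g_nonneg[of x] by simp
  qed
  have meas: "entropy_density (exp 1) ?F ?G \<in> borel_measurable ?G"
    using measurable_entropy_density[of "exp 1" ?F ?G] by (simp add: measurable_def)
  have "integrable ?G (entropy_density (exp 1) ?F ?G)"
    using int by (subst integrable_cong_AE[OF meas _ ae]) auto
  moreover have "KL_divergence (exp 1) ?F ?G = (\<integral>x. ln (g x / f x) \<partial>?G)"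
    unfolding KL_divergence_def by (rule integral_cong_AE[OF meas _ ae]) simp
  ultimately show ?thesis
    using ac by (simp add: KL_def)
qed

lemma KL_finiteD:
  assumes "KL P R < \<infinity>"
  shows "absolutely_continuous R P" "integrable P (entropy_density (exp 1) R P)"
    "KL P R = ereal (\<integral>x. entropy_density (exp 1) R P x \<partial>P)"
  using assms by (auto simp: KL_def KL_divergence_def split: if_splits)

text \<open>\<open>P\<close> is \<open>R\<close> weighted by the derivative, so the zeros of the
  derivative carry no mass of \<open>P\<close>. The value \<open>\<infinity>\<close>, which
  \<open>enn2real\<close> would also send to 0, occurs only on a null set of
  \<open>R\<close>.\<close>

lemma AE_RN_deriv_pos:
  assumes R: "sigma_finite_measure R" and P: "sigma_finite_measure P"
    and sets: "sets P = sets R" and ac: "absolutely_continuous R P"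
  shows "AE x in P. 0 < enn2real (RN_deriv R P x)"
proof -
  interpret R: sigma_finite_measure R by fact
  have "AE x in R. 0 < RN_deriv R P x \<longrightarrow> 0 < enn2real (RN_deriv R P x)"
    using R.RN_deriv_finite[OF P ac sets]
    by eventually_elim (auto simp: enn2real_positive_iff top.not_eq_extremum)
  then have "AE x in density R (RN_deriv R P). 0 < enn2real (RN_deriv R P x)"
    by (subst AE_density) auto
  then show ?thesis
    unfolding R.density_RN_deriv[OF ac sets] .
qed

text \<open>Passing from \<open>R\<close> to \<open>density R w\<close> divides the derivative of
  \<open>P\<close> by \<open>w\<close>, and the logarithm of the quotient splits. With
  \<open>w\<close> the normalised tempered likelihood, divergence from the tempered posterior is
  expressed through divergence from the prior.\<close>

lemma KL_tilted:
  fixes w :: "'a \<Rightarrow> real"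
  assumes R: "sigma_finite_measure R" and P: "sigma_finite_measure P"
    and sets: "sets P = sets R"
    and w [measurable]: "w \<in> borel_measurable R"  and w_pos: "\<And>x. x \<in> space R \<Longrightarrow> 0 < w x"
    and KL: "KL P R = ereal c" and int: "integrable P (\<lambda>x. ln (w x))"
  shows "KL P (density R w) = ereal (c - (\<integral>x. ln (w x) \<partial>P))"
proof -
  interpret R: sigma_finite_measure R by fact
  have fin: "KL P R < \<infinity>" by (simp add: KL)
  note * = KL_finiteD[OF fin]
  define k where "k x = enn2real (RN_deriv R P x)" for x
  have [measurable]: "k \<in> borel_measurable R"
    by (simp add: k_def[abs_def])
  have ae_k: "AE x in R. RN_deriv R P x = ennreal (k x)"
    using R.RN_deriv_finite[OF P *(1) sets]
    by eventually_elim (auto simp: k_def top.not_eq_extremum)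
  have dens: "density R k = P"
  proof -
    have "density R k = density R (RN_deriv R P)"
      using ae_k by (intro density_cong) auto
    then show ?thesis
      using R.density_RN_deriv[OF *(1) sets] by simp
  qed
  have [measurable]: "k \<in> borel_measurable P" "w \<in> borel_measurable P"
    unfolding measurable_cong_sets[OF sets refl] by measurable
  have ed: "entropy_density (exp 1) R P x = ln (k x)" for x
    by (simp add: entropy_density_def k_def log_exp_1)
  have ae: "AE x in P. ln (k x / w x) = ln (k x) - ln (w x)"
    using AE_RN_deriv_pos[OF R P sets *(1)] AE_space
  proof eventually_elim
    case (elim x)
    then have "0 < w x"
      by (intro w_pos) (simp add: sets_eq_imp_space_eq[OF sets])
    with elim(1) show ?case
      unfolding k_def by (simp add: ln_div)
  qed
  have i: "integrable P (\<lambda>x. ln (k x) - ln (w x))"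
    using *(2) int by (simp add: ed[abs_def])
  have i': "integrable P (\<lambda>x. ln (k x / w x))"
    using i by (subst integrable_cong_AE[OF _ _ ae]) auto
  have k_nonneg: "0 \<le> k x" for x
    by (simp add: k_def)
  have "KL (density R k) (density R w) = ereal (\<integral>x. ln (k x / w x) \<partial>density R k)"
    using i' by (intro KL_density_density R w_pos) (auto simp: dens k_nonneg)
  also have "(\<integral>x. ln (k x / w x) \<partial>density R k) = (\<integral>x. ln (k x) - ln (w x) \<partial>P)"
    unfolding dens by (intro integral_cong_AE ae) auto
  also have "\<dots> = c - (\<integral>x. ln (w x) \<partial>P)"
    using *(2,3) int KL by (subst Bochner_Integration.integral_diff) (auto simp: ed[abs_def])
  finally show ?thesis
    by (simp add: dens)
qed

text \<open>
  The variational inequality follows by integrating \<open>u \<le> exp u - 1\<close> at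
  \<open>u = h - ln (dP / dR) - ln v\<close> against \<open>P\<close>.
\<close>

lemma donsker_varadhan_le:
  fixes h :: "'a \<Rightarrow> real"
  assumes P: "prob_space P" and R: "sigma_finite_measure R" and sets: "sets P = sets R"
    and h [measurable]: "h \<in> borel_measurable R" and h_nonneg: "\<And>x. x \<in> space R \<Longrightarrow> 0 \<le> h x"
    and KL: "KL P R \<le> ereal c"
    and v: "(\<integral>\<^sup>+x. ennreal (exp (h x)) \<partial>R) \<le> ennreal v" "0 < v"
  shows "(\<integral>\<^sup>+x. ennreal (h x) \<partial>P) \<le> ennreal (c + ln v)"
proof -
  interpret P: prob_space P by fact
  interpret R: sigma_finite_measure R by fact
  have fin: "KL P R < \<infinity>" using KL by (rule order_le_less_trans) simp
  note * = KL_finiteD[OF fin]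
  define k where "k x = enn2real (RN_deriv R P x)" for x
  have k_nonneg: "0 \<le> k x" for x
    by (simp add: k_def)
  have ed: "entropy_density (exp 1) R P x = ln (k x)" for x
    by (simp add: entropy_density_def k_def log_exp_1)
  have [measurable]: "k \<in> borel_measurable R"
    by (simp add: k_def[abs_def])
  have [measurable]: "k \<in> borel_measurable P" "h \<in> borel_measurable P"
    unfolding measurable_cong_sets[OF sets refl] by measurable
  have sp: "space P = space R" by (rule sets_eq_imp_space_eq[OF sets])
  let ?g = "\<lambda>x. exp (h x) / (k x * v)"
  have ae: "AE x in P. 0 < k x"
    unfolding k_def by (rule AE_RN_deriv_pos[OF R P.sigma_finite_measure_axioms sets *(1)])
  have "(\<integral>\<^sup>+x. ennreal (?g x) \<partial>P) = (\<integral>\<^sup>+x. ennreal (?g x) \<partial>density R (RN_deriv R P))"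
    by (simp add: R.density_RN_deriv[OF *(1) sets])
  also have "\<dots> = (\<integral>\<^sup>+x. RN_deriv R P x * ennreal (?g x) \<partial>R)"
    by (rule nn_integral_density) auto
  \<comment> \<open>Where \<open>k x = 0\<close>, division by zero makes the left side 0; hence an
    inequality instead of an equation.\<close>
  also have "\<dots> \<le> (\<integral>\<^sup>+x. ennreal (exp (h x)) * ennreal (1 / v) \<partial>R)"
  proof (rule nn_integral_mono_AE, use R.RN_deriv_finite[OF P.sigma_finite_measure_axioms *(1) sets] in eventually_elim)
    case (elim x)
    then have "RN_deriv R P x = ennreal (k x)" by (simp add: k_def top.not_eq_extremum)
    moreover have "0 \<le> k x" by (simp add: k_def)
    ultimately have "RN_deriv R P x * ennreal (?g x) = ennreal (k x * ?g x)"
      by (simp only: ennreal_mult')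
    also have "\<dots> \<le> ennreal (exp (h x) * (1 / v))"
      using v(2) by (intro ennreal_leI) (cases "k x = 0"; simp)
    finally show ?case
      by (simp only: ennreal_mult'[OF exp_ge_zero])
  qed
  also have "\<dots> = (\<integral>\<^sup>+x. ennreal (exp (h x)) \<partial>R) * ennreal (1 / v)"
    by (rule nn_integral_multc) auto
  also have "\<dots> \<le> ennreal v * ennreal (1 / v)"
    by (intro mult_right_mono v) auto
  also have "\<dots> = 1"
    using v(2) by (simp flip: ennreal_mult)
  finally have g1: "(\<integral>\<^sup>+x. ennreal (?g x) \<partial>P) \<le> 1" .
  have ig: "integrable P ?g"
    using v(2) g1 by (intro integrableI_nonneg) (auto simp: k_nonneg order_le_less_trans)
  have g1': "(\<integral>x. ?g x \<partial>P) \<le> 1"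
    using g1 v(2) by (subst integral_eq_nn_integral) (auto simp: k_nonneg enn2real_leI)
  have bound: "AE x in P. h x \<le> ln (k x) + ln v + ?g x - 1"
    using ae
  proof eventually_elim
    case (elim x)
    have "1 + (h x - ln (k x) - ln v) \<le> exp (h x - ln (k x) - ln v)"
      by (rule exp_ge_add_one_self)
    also have "\<dots> = ?g x"
      using elim v(2) by (simp add: exp_diff)
    finally show ?case by simp
  qed
  have il: "integrable P (\<lambda>x. ln (k x))"
    using *(2) by (simp add: ed[abs_def])
  have ib: "integrable P (\<lambda>x. ln (k x) + ln v + ?g x - 1)"
    using il ig by (intro Bochner_Integration.integrable_diff Bochner_Integration.integrable_add) auto
  \<comment> \<open>\<open>h\<close> lies between 0 and the integrable function in
    \<open>bound\<close>, so its integrability is derived here.\<close>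
  have ih: "integrable P h"
  proof (rule Bochner_Integration.integrable_bound[OF ib])
    show "AE x in P. norm (h x) \<le> norm (ln (k x) + ln v + ?g x - 1)"
      using bound AE_space
    proof eventually_elim
      case (elim x)
      moreover have "0 \<le> h x"
        using elim(2) by (intro h_nonneg) (simp add: sp)
      ultimately show ?case by simp
    qed
  qed auto
  have "(\<integral>x. h x \<partial>P) \<le> (\<integral>x. ln (k x) + ln v + ?g x - 1 \<partial>P)"
    by (rule integral_mono_AE[OF ih ib bound])
  also have "\<dots> = (\<integral>x. ln (k x) \<partial>P) + ln v + (\<integral>x. ?g x \<partial>P) - 1"
    using il ig by (simp add: P.prob_space)
  also have "\<dots> \<le> c + ln v"
    using *(3) KL g1' by (simp add: ed[abs_def])
  finally have "(\<integral>x. h x \<partial>P) \<le> c + ln v" .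
  then show ?thesis
    using ih by (subst nn_integral_eq_integral) (auto simp: sp h_nonneg intro!: ennreal_leI)
qed

section \<open>Product measures: densities, orthogonality of centred coordinates, Chebyshev
  bound\<close>

section \<open>Products\<close>

text \<open>A finite product measure is determined by its values on boxes. On a box both density and
  indicator factor over the coordinates, so the integral is a product of one-dimensional
  integrals.\<close>

lemma PiM_density:
  fixes f :: "'i \<Rightarrow> 'a \<Rightarrow> ennreal"
  assumes I: "finite I"
    and M: "\<And>i. sigma_finite_measure (M i)" "\<And>i. sigma_finite_measure (density (M i) (f i))"
    and f [measurable]: "\<And>i. i \<in> I \<Longrightarrow> f i \<in> borel_measurable (M i)"
  shows "density (PiM I M) (\<lambda>x. \<Prod>i\<in>I. f i (x i)) = PiM I (\<lambda>i. density (M i) (f i))"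
proof -
  interpret M: product_sigma_finite M by (rule product_sigma_finite.intro, rule M)
  interpret D: product_sigma_finite "\<lambda>i. density (M i) (f i)" by (rule product_sigma_finite.intro, rule M)
  show ?thesis
  proof (rule D.PiM_eqI[OF I])
    show "sets (density (PiM I M) (\<lambda>x. \<Prod>i\<in>I. f i (x i))) = sets (PiM I (\<lambda>i. density (M i) (f i)))"
      by (simp cong: sets_PiM_cong)
  next
    fix A assume "\<And>i. i \<in> I \<Longrightarrow> A i \<in> sets (density (M i) (f i))"
    then have [measurable]: "\<And>i. i \<in> I \<Longrightarrow> A i \<in> sets (M i)" by simp
    have "emeasure (density (PiM I M) (\<lambda>x. \<Prod>i\<in>I. f i (x i))) (Pi\<^sub>E I A) =
        (\<integral>\<^sup>+x. (\<Prod>i\<in>I. f i (x i)) * indicator (Pi\<^sub>E I A) x \<partial>PiM I M)"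
      using I by (intro emeasure_density sets_PiM_I_finite) auto
    also have "\<dots> = (\<integral>\<^sup>+x. (\<Prod>i\<in>I. f i (x i) * indicator (A i) (x i)) \<partial>PiM I M)"
    proof (rule nn_integral_cong)
      fix x assume "x \<in> space (PiM I M)"
      then have "indicator (Pi\<^sub>E I A) x = (\<Prod>i\<in>I. indicator (A i) (x i) :: ennreal)"
        using I by (auto simp: indicator_def space_PiM PiE_iff prod.neutral intro!: prod_zero)
      then show "(\<Prod>i\<in>I. f i (x i)) * indicator (Pi\<^sub>E I A) x = (\<Prod>i\<in>I. f i (x i) * indicator (A i) (x i))"
        by (simp add: prod.distrib)
    qed
    also have "\<dots> = (\<Prod>i\<in>I. \<integral>\<^sup>+x. f i x * indicator (A i) x \<partial>M i)"
      using I by (intro M.product_nn_integral_prod) auto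
    also have "\<dots> = (\<Prod>i\<in>I. emeasure (density (M i) (f i)) (A i))"
      by (intro prod.cong refl) (simp add: emeasure_density)
    finally show "emeasure (density (PiM I M) (\<lambda>x. \<Prod>i\<in>I. f i (x i))) (Pi\<^sub>E I A) =
        (\<Prod>i\<in>I. emeasure (density (M i) (f i)) (A i))" .
  qed
qed

lemma integrable_PiM_component:
  fixes g :: "'a \<Rightarrow> real"
  assumes M: "\<And>i. prob_space (M i)" and "i \<in> I" and g: "integrable (M i) g"
  shows "integrable (PiM I M) (\<lambda>x. g (x i))" "(\<integral>x. g (x i) \<partial>PiM I M) = (\<integral>x. g x \<partial>M i)"
proof -
  have d: "distr (PiM I M) (M i) (\<lambda>x. x i) = M i"
    using M \<open>i \<in> I\<close> by (rule distr_PiM_component)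
  have [measurable]: "(\<lambda>x. x i) \<in> measurable (PiM I M) (M i)" "g \<in> borel_measurable (M i)"
    using \<open>i \<in> I\<close> g by auto
  show "integrable (PiM I M) (\<lambda>x. g (x i))"
    using g integrable_distr[of "\<lambda>x. x i" "PiM I M" "M i" g] by (simp add: d)
  show "(\<integral>x. g (x i) \<partial>PiM I M) = (\<integral>x. g x \<partial>M i)"
    using integral_distr[of "\<lambda>x. x i" "PiM I M" "M i" g] by (simp add: d)
qed

text \<open>Expanding the square leaves only the diagonal: the coordinates are independent and
  centred, so every cross term has integral 0.\<close>

lemma second_moment_sum_PiM:
  fixes g :: "'i \<Rightarrow> 'a \<Rightarrow> real"
  assumes I: "finite I" and M: "\<And>i. prob_space (M i)"
    and g [measurable]: "\<And>i. i \<in> I \<Longrightarrow> g i \<in> borel_measurable (M i)"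
    and sq: "\<And>i. i \<in> I \<Longrightarrow> integrable (M i) (\<lambda>x. (g i x)\<^sup>2)"
    and centred: "\<And>i. i \<in> I \<Longrightarrow> (\<integral>x. g i x \<partial>M i) = 0"
  shows "integrable (PiM I M) (\<lambda>x. (\<Sum>i\<in>I. g i (x i))\<^sup>2)"
    "(\<integral>x. (\<Sum>i\<in>I. g i (x i))\<^sup>2 \<partial>PiM I M) = (\<Sum>i\<in>I. \<integral>x. (g i x)\<^sup>2 \<partial>M i)"
proof -
  interpret M: prob_space "M i" for i by (rule M)
  interpret product_sigma_finite M ..
  have g_int: "integrable (M i) (g i)" if "i \<in> I" for i
    by (rule finite_measure.square_integrable_imp_integrable[OF prob_space.finite_measure, OF M g sq, OF that that])
  \<comment> \<open>\<open>F i j k\<close> is the factor in coordinate \<open>k\<close> of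
    \<open>g i (x i) * g j (x j)\<close>, written as a product over all of \<open>I\<close>. The two
    conditionals are multiplied so that \<open>i = j\<close> yields a square.\<close>
  define F where "F i j k x = (if k = i then g k x else 1) * (if k = j then g k x else 1)" for i j k x
  have F_int: "integrable (M k) (F i j k)" if "i \<in> I" "j \<in> I" "k \<in> I" for i j k
    using sq[OF that(1)] g_int[OF that(1)] g_int[OF that(2)]
    by (cases "k = i"; cases "k = j") (auto simp: F_def[abs_def] power2_eq_square)
  have F_prod: "(\<Prod>k\<in>I. F i j k (x k)) = g i (x i) * g j (x j)" if "i \<in> I" "j \<in> I" for i j x
    using I that by (simp add: F_def prod.distrib)
  have int: "integrable (PiM I M) (\<lambda>x. g i (x i) * g j (x j))"
    and eq: "(\<integral>x. g i (x i) * g j (x j) \<partial>PiM I M) = (\<Prod>k\<in>I. \<integral>x. F i j k x \<partial>M k)"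
    if "i \<in> I" "j \<in> I" for i j
    using product_integrable_prod[OF I F_int, OF that] product_integral_prod[OF I F_int, OF that]
    by (simp_all add: F_prod that)
  have eq': "(\<integral>x. g i (x i) * g j (x j) \<partial>PiM I M) = (if i = j then \<integral>x. (g i x)\<^sup>2 \<partial>M i else 0)"
    if "i \<in> I" "j \<in> I" for i j
  proof (cases "i = j")
    case True
    then show ?thesis
      using integrable_PiM_component(2)[where M=M and g="\<lambda>x. (g i x)\<^sup>2", OF M that(1) sq[OF that(1)]]
      by (simp add: power2_eq_square)
  next
    case False
    then have "(\<integral>x. F i j i x \<partial>M i) = 0"
      using centred[OF that(1)] by (simp add: F_def[abs_def])
    then have "(\<Prod>k\<in>I. \<integral>x. F i j k x \<partial>M k) = 0"
      using I that by (intro prod_zero) auto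
    with False show ?thesis by (simp add: eq that)
  qed
  have sq_eq: "(\<Sum>i\<in>I. g i (x i))\<^sup>2 = (\<Sum>i\<in>I. \<Sum>j\<in>I. g i (x i) * g j (x j))" for x
    by (simp add: power2_eq_square sum_product)
  show "integrable (PiM I M) (\<lambda>x. (\<Sum>i\<in>I. g i (x i))\<^sup>2)"
    unfolding sq_eq by (intro Bochner_Integration.integrable_sum int)
  have "(\<integral>x. (\<Sum>i\<in>I. g i (x i))\<^sup>2 \<partial>PiM I M) =
      (\<Sum>i\<in>I. \<Sum>j\<in>I. \<integral>x. g i (x i) * g j (x j) \<partial>PiM I M)"
    unfolding sq_eq by (simp add: Bochner_Integration.integral_sum int)
  also have "\<dots> = (\<Sum>i\<in>I. \<integral>x. (g i x)\<^sup>2 \<partial>M i)"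
    using I by (intro sum.cong refl) (simp add: eq')
  finally show "(\<integral>x. (\<Sum>i\<in>I. g i (x i))\<^sup>2 \<partial>PiM I M) = (\<Sum>i\<in>I. \<integral>x. (g i x)\<^sup>2 \<partial>M i)" .
qed

text \<open>Chebyshev's inequality for the centred sum \<open>U\<close>, with a bound
  \<open>v\<close> on the summed raw second moments in place of the variance.\<close>

lemma sum_PiM_upper_tail:
  fixes g :: "'a \<Rightarrow> real"
  assumes M: "prob_space M" and g [measurable]: "g \<in> borel_measurable M"
    and sq: "integrable M (\<lambda>x. (g x)\<^sup>2)"
    and v: "n * (\<integral>x. (g x)\<^sup>2 \<partial>M) \<le> v" and \<eta>: "0 < \<eta>"
  defines "S \<equiv> PiM {1..n::nat} (\<lambda>i. M)"
  shows "{x \<in> space S. (\<Sum>i=1..n. g (x i)) > n * (\<integral>x. g x \<partial>M) + sqrt (v / \<eta>)} \<in> sets S"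
    "measure S {x \<in> space S. (\<Sum>i=1..n. g (x i)) > n * (\<integral>x. g x \<partial>M) + sqrt (v / \<eta>)} \<le> \<eta>"
proof -
  interpret M: prob_space M by fact
  interpret S: prob_space S
    unfolding S_def by (rule prob_space_PiM) (rule M)
  define c where "c = (\<integral>x. g x \<partial>M)"
  define U where "U x = (\<Sum>i=1..n. g (x i) - c)" for x :: "nat \<Rightarrow> 'a"
  have g_int: "integrable M g"
    by (rule M.square_integrable_imp_integrable[OF g sq])
  have sq': "integrable M (\<lambda>x. (g x - c)\<^sup>2)"
    using g_int sq by (simp add: power2_diff)
  have U_sq: "integrable S (\<lambda>x. (U x)\<^sup>2)" and "(\<integral>x. (U x)\<^sup>2 \<partial>S) = (\<Sum>i=1..n. \<integral>x. (g x - c)\<^sup>2 \<partial>M)"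
    unfolding U_def S_def
    using second_moment_sum_PiM[where I="{1..n}" and M="\<lambda>i. M" and g="\<lambda>i x. g x - c"] M sq' g_int
    by (simp_all add: c_def M.prob_space)
  then have "(\<integral>x. (U x)\<^sup>2 \<partial>S) = n * ((\<integral>x. (g x)\<^sup>2 \<partial>M) - c\<^sup>2)"
    using M.variance_eq[OF g_int sq] by (simp add: c_def)
  \<comment> \<open>Subtracting \<open>c^2\<close> only decreases the value: the variance is at most
    the raw second moment.\<close>
  then have U_v: "(\<integral>x. (U x)\<^sup>2 \<partial>S) \<le> v"
    using v by (simp add: algebra_simps) (smt (verit) mult_nonneg_nonneg of_nat_0_le_iff zero_le_power2)
  have v_nonneg: "0 \<le> v"
    by (rule order_trans[OF _ U_v]) simp
  have [measurable]: "U \<in> borel_measurable S"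
    unfolding U_def S_def by measurable
  have eq: "{x \<in> space S. (\<Sum>i=1..n. g (x i)) > n * c + sqrt (v / \<eta>)} = {x \<in> space S. U x > sqrt (v / \<eta>)}"
    by (auto simp: U_def sum_subtractf)
  show "{x \<in> space S. (\<Sum>i=1..n. g (x i)) > n * (\<integral>x. g x \<partial>M) + sqrt (v / \<eta>)} \<in> sets S"
    unfolding c_def[symmetric] eq by measurable
  have "measure S {x \<in> space S. U x > sqrt (v / \<eta>)} \<le> \<eta>"
  proof (cases "v = 0")
    \<comment> \<open>For \<open>v = 0\<close> the Chebyshev quotient below would be
      \<open>0 / 0\<close>. Here \<open>U\<close> vanishes almost surely, and the strict inequality
      \<open>U x > 0\<close> defines a null event.\<close>
    case True
    then have "(\<integral>x. (U x)\<^sup>2 \<partial>S) = 0"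
      using U_v by (intro antisym) auto
    then have "AE x in S. U x = 0"
      using integral_nonneg_eq_0_iff_AE[OF U_sq] by simp
    then have "emeasure S {x \<in> space S. U x > sqrt (v / \<eta>)} = 0"
      using True by (intro emeasure_eq_0_AE) (auto elim: eventually_mono)
    then show ?thesis
      using \<eta> by (simp add: measure_def)
  next
    case False
    then have v_pos: "0 < v" using v_nonneg by simp
    have "measure S {x \<in> space S. U x > sqrt (v / \<eta>)} \<le> measure S {x \<in> space S. (U x)\<^sup>2 \<ge> v / \<eta>}"
    proof (intro S.finite_measure_mono subsetI CollectI conjI)
      fix x assume "x \<in> {x \<in> space S. U x > sqrt (v / \<eta>)}"
      then have "(sqrt (v / \<eta>))\<^sup>2 \<le> (U x)\<^sup>2"
        using v_pos \<eta> by (intro power_mono) auto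
      then show "v / \<eta> \<le> (U x)\<^sup>2"
        using v_pos \<eta> by simp
    qed auto
    also have "\<dots> \<le> (\<integral>x. (U x)\<^sup>2 \<partial>S) / (v / \<eta>)"
      using v_pos \<eta> by (intro integral_Markov_inequality_measure[OF U_sq, of "{}"]) auto
    also have "\<dots> \<le> v / (v / \<eta>)"
      using v_pos \<eta> U_v by (intro divide_right_mono) auto
    also have "\<dots> = \<eta>"
      using v_pos by simp
    finally show ?thesis .
  qed
  then show "measure S {x \<in> space S. (\<Sum>i=1..n. g (x i)) > n * (\<integral>x. g x \<partial>M) + sqrt (v / \<eta>)} \<le> \<eta>"
    unfolding c_def[symmetric] eq .
qed

section \<open>Gaussian laws: product structure, moments, mutual divergence\<close>

section \<open>Isotropic Gaussians\<close>

definition normal_law :: "real \<Rightarrow> real \<Rightarrow> real measure" where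
  "normal_law m \<sigma> = density lborel (\<lambda>x. ennreal (normal_density m \<sigma> x))"

lemma sets_normal_law [simp, measurable_cong]: "sets (normal_law m \<sigma>) = sets borel"
  by (simp add: normal_law_def)

lemma prob_space_normal_law: "0 < \<sigma> \<Longrightarrow> prob_space (normal_law m \<sigma>)"
  unfolding normal_law_def by (rule prob_space_normal_density)

lemma normal_law_moments:
  assumes "0 < \<sigma>"
  shows "integrable (normal_law m \<sigma>) (\<lambda>x. (x - m)\<^sup>2)"
    "(\<integral>x. x - m \<partial>normal_law m \<sigma>) = 0"
    "(\<integral>x. (x - m)\<^sup>2 \<partial>normal_law m \<sigma>) = \<sigma>\<^sup>2"
  \<comment> \<open>Index 1 of the even moments is the second moment, index 0 of the odd ones is the
    first.\<close>
  using integrable_normal_moment[OF assms, of m 2] integral_normal_moment_even[OF assms, of m 1]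
    integral_normal_moment_odd[OF assms, of m 0] assms
  by (auto simp: normal_law_def integrable_density integral_density normal_density_nonneg fact_numeral)

text \<open>Lebesgue measure is the image of a product of one-dimensional Lebesgue measures. Pulled
  back along that map, the Gaussian density becomes a product over coordinates, to which
  \<open>PiM_density\<close> applies; moments can then be computed from independent
  coordinates.\<close>

lemma iso_gaussian_eq_distr:
  assumes "0 < \<sigma>"
  shows "iso_gaussian m \<sigma> = distr (PiM Basis (\<lambda>b. normal_law (m \<bullet> b) \<sigma>)) borel (\<lambda>x. \<Sum>b\<in>Basis. x b *\<^sub>R b)"
proof -
  let ?T = "\<lambda>x. \<Sum>b\<in>Basis. x b *\<^sub>R b :: 'a"
  let ?f = "\<lambda>b t. ennreal (normal_density (m \<bullet> b) \<sigma> t)"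
  have f: "ennreal (\<Prod>b\<in>Basis. normal_density (m \<bullet> b) \<sigma> (x \<bullet> b)) = (\<Prod>b\<in>Basis. ?f b (x \<bullet> b))" for x
    by (simp add: prod_ennreal normal_density_nonneg)
  have "iso_gaussian m \<sigma> = density (distr (PiM Basis (\<lambda>b. lborel)) borel ?T) (\<lambda>x. \<Prod>b\<in>Basis. ?f b (x \<bullet> b))"
    unfolding iso_gaussian_def f by (subst lborel_eq) simp
  also have "\<dots> = distr (density (PiM Basis (\<lambda>b. lborel)) (\<lambda>x. \<Prod>b\<in>Basis. ?f b (?T x \<bullet> b))) borel ?T"
    by (rule density_distr) measurable
  also have "(\<lambda>x. \<Prod>b\<in>Basis. ?f b (?T x \<bullet> b)) = (\<lambda>x. \<Prod>b\<in>Basis. ?f b (x b))"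
    by (intro ext prod.cong refl) simp
  also have "density (PiM Basis (\<lambda>b. lborel)) \<dots> = PiM Basis (\<lambda>b. normal_law (m \<bullet> b) \<sigma>)"
    unfolding normal_law_def using assms
    by (intro PiM_density) (auto intro!: lborel.sigma_finite_measure_axioms prob_space_imp_sigma_finite prob_space_normal_density)
  finally show ?thesis .
qed

lemma sets_iso_gaussian [simp, measurable_cong]: "sets (iso_gaussian m \<sigma>) = sets borel"
  by (simp add: iso_gaussian_def)

lemma space_iso_gaussian [simp]: "space (iso_gaussian m \<sigma>) = UNIV"
  by (simp add: iso_gaussian_def)

lemma prob_space_iso_gaussian:
  assumes "0 < \<sigma>"
  shows "prob_space (iso_gaussian m \<sigma>)"
  unfolding iso_gaussian_eq_distr[OF assms] using assms
  by (intro prob_space.prob_space_distr prob_space_PiM prob_space_normal_law) measurable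

text \<open>In coordinates, \<open>u \<bullet> (x - m)\<close> is a sum of independent centred terms
  with variances \<open>(u \<bullet> b)^2 * \<sigma>^2\<close>, and the squares of the coordinates
  of \<open>u\<close> add up to its squared norm.\<close>

lemma iso_gaussian_second_moment:
  assumes \<sigma>: "0 < \<sigma>"
  shows "integrable (iso_gaussian m \<sigma>) (\<lambda>x. (u \<bullet> (x - m))\<^sup>2)"
    "(\<integral>x. (u \<bullet> (x - m))\<^sup>2 \<partial>iso_gaussian m \<sigma>) = \<sigma>\<^sup>2 * (norm u)\<^sup>2"
proof -
  let ?N = "\<lambda>b. normal_law (m \<bullet> b) \<sigma>"
  let ?T = "\<lambda>x. \<Sum>b\<in>Basis. x b *\<^sub>R b :: 'a"
  let ?g = "\<lambda>b t. (u \<bullet> b) * (t - m \<bullet> b)"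
  have eq: "u \<bullet> (?T x - m) = (\<Sum>b\<in>Basis. ?g b (x b))" for x
    by (subst euclidean_inner) (simp add: inner_diff_left)
  note s = second_moment_sum_PiM[of Basis ?N ?g]
  have i: "integrable (PiM Basis ?N) (\<lambda>x. (u \<bullet> (?T x - m))\<^sup>2)"
    unfolding eq using \<sigma> by (intro s) (auto simp: prob_space_normal_law normal_law_moments power_mult_distrib)
  then show "integrable (iso_gaussian m \<sigma>) (\<lambda>x. (u \<bullet> (x - m))\<^sup>2)"
    unfolding iso_gaussian_eq_distr[OF \<sigma>] by (subst integrable_distr_eq) auto
  have "(\<integral>x. (u \<bullet> (x - m))\<^sup>2 \<partial>iso_gaussian m \<sigma>) = (\<integral>x. (u \<bullet> (?T x - m))\<^sup>2 \<partial>PiM Basis ?N)"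
    unfolding iso_gaussian_eq_distr[OF \<sigma>] by (subst integral_distr) auto
  also have "\<dots> = (\<Sum>b\<in>Basis. \<integral>x. (?g b x)\<^sup>2 \<partial>?N b)"
    unfolding eq using \<sigma> by (intro s) (auto simp: prob_space_normal_law normal_law_moments power_mult_distrib)
  also have "\<dots> = (\<Sum>b\<in>Basis. (u \<bullet> b)\<^sup>2 * \<sigma>\<^sup>2)"
    using \<sigma> by (simp add: power_mult_distrib normal_law_moments)
  also have "\<dots> = \<sigma>\<^sup>2 * (norm u)\<^sup>2"
    by (simp add: norm_eq_sqrt_inner euclidean_inner[of u u] power2_eq_square sum_distrib_left sum_nonneg mult.commute)
  finally show "(\<integral>x. (u \<bullet> (x - m))\<^sup>2 \<partial>iso_gaussian m \<sigma>) = \<sigma>\<^sup>2 * (norm u)\<^sup>2" .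
qed

text \<open>The first absolute moment is at most the root of the second, because the variance of
  \<open>\<bar>u \<bullet> (x - m)\<bar>\<close> is nonnegative.\<close>

lemma iso_gaussian_abs_moment:
  assumes \<sigma>: "0 < \<sigma>"
  shows "integrable (iso_gaussian m \<sigma>) (\<lambda>x. u \<bullet> (x - m))"
    "(\<integral>x. \<bar>u \<bullet> (x - m)\<bar> \<partial>iso_gaussian m \<sigma>) \<le> \<sigma> * norm u"
proof -
  interpret G: prob_space "iso_gaussian m \<sigma>" by (rule prob_space_iso_gaussian[OF \<sigma>])
  note sq = iso_gaussian_second_moment[OF \<sigma>, of m u]
  have "(\<lambda>x. u \<bullet> (x - m)) \<in> borel_measurable (iso_gaussian m \<sigma>)"
    unfolding measurable_cong_sets[OF sets_iso_gaussian refl] by simp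
  then show i: "integrable (iso_gaussian m \<sigma>) (\<lambda>x. u \<bullet> (x - m))"
    by (rule G.square_integrable_imp_integrable[OF _ sq(1)])
  have "0 \<le> (\<integral>x. (\<bar>u \<bullet> (x - m)\<bar> - (\<integral>x. \<bar>u \<bullet> (x - m)\<bar> \<partial>iso_gaussian m \<sigma>))\<^sup>2 \<partial>iso_gaussian m \<sigma>)"
    by (rule integral_nonneg_AE) simp
  also have "\<dots> = \<sigma>\<^sup>2 * (norm u)\<^sup>2 - (\<integral>x. \<bar>u \<bullet> (x - m)\<bar> \<partial>iso_gaussian m \<sigma>)\<^sup>2"
    using G.variance_eq[of "\<lambda>x. \<bar>u \<bullet> (x - m)\<bar>"] i sq by (simp only: integrable_abs power2_abs)
  finally have "(\<integral>x. \<bar>u \<bullet> (x - m)\<bar> \<partial>iso_gaussian m \<sigma>)\<^sup>2 \<le> (\<sigma> * norm u)\<^sup>2"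
    by (simp only: power_mult_distrib)
  then show "(\<integral>x. \<bar>u \<bullet> (x - m)\<bar> \<partial>iso_gaussian m \<sigma>) \<le> \<sigma> * norm u"
    by (rule power2_le_imp_le) (use \<sigma> in simp)
qed

lemma sum_Basis_inner_sq: "(\<Sum>b\<in>Basis. (x \<bullet> b)\<^sup>2) = (norm x)\<^sup>2"
  unfolding power2_norm_eq_inner by (subst euclidean_inner[of x x]) (simp add: power2_eq_square)

text \<open>Each coordinate is centred. This removes the cross term in
  \<open>iso_gaussian_norm_moment\<close>.\<close>

lemma iso_gaussian_first_moment:
  assumes \<sigma>: "0 < \<sigma>"
  shows "(\<integral>x. u \<bullet> (x - m) \<partial>iso_gaussian m \<sigma>) = 0"
proof -
  let ?N = "\<lambda>b. normal_law (m \<bullet> b) \<sigma>"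
  let ?T = "\<lambda>x. \<Sum>b\<in>Basis. x b *\<^sub>R b :: 'a"
  have N: "prob_space (?N b)" for b
    by (rule prob_space_normal_law[OF \<sigma>])
  have i: "integrable (?N b) (\<lambda>t. (u \<bullet> b) * (t - m \<bullet> b))" for b
    by (rule integrable_mult_right,
        rule finite_measure.square_integrable_imp_integrable[OF prob_space.finite_measure, OF N _ normal_law_moments(1)[OF \<sigma>]]) simp
  have comp: "integrable (PiM Basis ?N) (\<lambda>x. (u \<bullet> b) * (x b - m \<bullet> b))"
    "(\<integral>x. (u \<bullet> b) * (x b - m \<bullet> b) \<partial>PiM Basis ?N) = (\<integral>t. (u \<bullet> b) * (t - m \<bullet> b) \<partial>?N b)"
    if "b \<in> Basis" for b
    using integrable_PiM_component[where M="?N", OF N that i] .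
  have "u \<bullet> (?T x - m) = (\<Sum>b\<in>Basis. (u \<bullet> b) * (x b - m \<bullet> b))" for x
    by (subst euclidean_inner) (simp add: inner_diff_left)
  then have "(\<integral>x. u \<bullet> (x - m) \<partial>iso_gaussian m \<sigma>) = (\<integral>x. (\<Sum>b\<in>Basis. (u \<bullet> b) * (x b - m \<bullet> b)) \<partial>PiM Basis ?N)"
    unfolding iso_gaussian_eq_distr[OF \<sigma>] by (subst integral_distr) auto
  also have "\<dots> = (\<Sum>b\<in>Basis. \<integral>t. (u \<bullet> b) * (t - m \<bullet> b) \<partial>?N b)"
    by (simp only: Bochner_Integration.integral_sum comp cong: sum.cong)
  also have "\<dots> = 0"
    using \<sigma> by (simp add: normal_law_moments)
  finally show ?thesis .
qed

text \<open>Expanding \<open>x - m'\<close> about the mean \<open>m\<close> gives one variance per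
  coordinate, a cross term of mean 0 and a constant. Stating it with
  \<open>has_bochner_integral\<close> carries integrability and value together.\<close>

lemma iso_gaussian_norm_moment:
  fixes m m' :: "'a::euclidean_space" and \<sigma> :: real
  assumes \<sigma>: "0 < \<sigma>"
  shows "has_bochner_integral (iso_gaussian m \<sigma>) (\<lambda>x. (norm (x - m'))\<^sup>2)
    (DIM('a) * \<sigma>\<^sup>2 + (norm (m - m'))\<^sup>2)"
proof -
  interpret G: prob_space "iso_gaussian m \<sigma>" by (rule prob_space_iso_gaussian[OF \<sigma>])
  have eq: "(norm (x - m'))\<^sup>2 =
      (\<Sum>b\<in>Basis. (b \<bullet> (x - m))\<^sup>2) + 2 * ((m - m') \<bullet> (x - m)) + (norm (m - m'))\<^sup>2" for x
  proof -
    have "(\<Sum>b\<in>Basis. (b \<bullet> (x - m))\<^sup>2) = (norm (x - m))\<^sup>2"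
      by (simp only: inner_commute[of _ "x - m"] sum_Basis_inner_sq)
    moreover have "x - m' = (x - m) + (m - m')"
      by simp
    ultimately show ?thesis
      by (simp only: power2_norm_eq_inner inner_add_left inner_add_right) (simp add: inner_commute)
  qed
  have i1: "has_bochner_integral (iso_gaussian m \<sigma>) (\<lambda>x. (b \<bullet> (x - m))\<^sup>2) (\<sigma>\<^sup>2)" if "b \<in> Basis" for b
    using iso_gaussian_second_moment[OF \<sigma>, of m b] that by (simp add: has_bochner_integral_iff)
  have i1': "has_bochner_integral (iso_gaussian m \<sigma>) (\<lambda>x. \<Sum>b\<in>Basis. (b \<bullet> (x - m))\<^sup>2)
      (\<Sum>b\<in>(Basis :: 'a set). \<sigma>\<^sup>2)"
    by (rule has_bochner_integral_sum[OF i1])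
  have i2: "has_bochner_integral (iso_gaussian m \<sigma>) (\<lambda>x. 2 * ((m - m') \<bullet> (x - m))) (2 * 0)"
    by (intro has_bochner_integral_mult_right)
      (simp add: has_bochner_integral_iff iso_gaussian_first_moment[OF \<sigma>] iso_gaussian_abs_moment(1)[OF \<sigma>])
  have i3: "has_bochner_integral (iso_gaussian m \<sigma>) (\<lambda>x. (norm (m - m'))\<^sup>2) ((norm (m - m'))\<^sup>2)"
    by (simp add: has_bochner_integral_iff G.prob_space[unfolded space_iso_gaussian])
  have "has_bochner_integral (iso_gaussian m \<sigma>) (\<lambda>x. (norm (x - m'))\<^sup>2)
      ((\<Sum>b\<in>(Basis :: 'a set). \<sigma>\<^sup>2) + 2 * 0 + (norm (m - m'))\<^sup>2)"
    using has_bochner_integral_add[OF has_bochner_integral_add[OF i1' i2] i3]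
    by (simp only: eq[symmetric])
  then show ?thesis by simp
qed

text \<open>The factors with \<open>2 * pi\<close> cancel, so the log-ratio of the densities is a
  constant plus squared distances to the two means. Their averages come from
  \<open>iso_gaussian_norm_moment\<close>, used once at the mean \<open>m\<close> itself and once at
  \<open>m'\<close>.\<close>

lemma KL_iso_gaussian:
  fixes m m' :: "'a::euclidean_space"
  assumes \<sigma>: "0 < \<sigma>" and \<tau>: "0 < \<tau>"
  shows "KL (iso_gaussian m \<sigma>) (iso_gaussian m' \<tau>) =
    ereal (DIM('a) * (ln (\<tau> / \<sigma>) + \<sigma>\<^sup>2 / (2 * \<tau>\<^sup>2) - 1 / 2) + (norm (m - m'))\<^sup>2 / (2 * \<tau>\<^sup>2))"
proof -
  interpret G: prob_space "iso_gaussian m \<sigma>" by (rule prob_space_iso_gaussian[OF \<sigma>])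
  let ?g = "\<lambda>m \<sigma> x. \<Prod>b\<in>Basis. normal_density (m \<bullet> b) \<sigma> (x \<bullet> b)"
  have g_pos: "0 < ?g m \<sigma> x" if "0 < \<sigma>" for m x :: 'a and \<sigma>
    using that by (intro prod_pos) (simp add: normal_density_pos)
  have ln_g: "ln (?g m \<sigma> x) = DIM('a) * (- ln \<sigma> - ln (2 * pi) / 2) - (norm (x - m))\<^sup>2 / (2 * \<sigma>\<^sup>2)"
    if "0 < \<sigma>" for m x :: 'a and \<sigma>
  proof -
    have "ln (normal_density (m \<bullet> b) \<sigma> (x \<bullet> b)) = - ln \<sigma> - ln (2 * pi) / 2 - ((x - m) \<bullet> b)\<^sup>2 / (2 * \<sigma>\<^sup>2)" for b
      using that by (simp add: normal_density_def ln_mult ln_div ln_sqrt ln_realpow inner_diff_left field_simps)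
    then have "ln (?g m \<sigma> x) = (\<Sum>b\<in>Basis. - ln \<sigma> - ln (2 * pi) / 2 - ((x - m) \<bullet> b)\<^sup>2 / (2 * \<sigma>\<^sup>2))"
      using that by (subst ln_prod) (simp_all add: normal_density_pos less_imp_neq[OF normal_density_pos, symmetric])
    also have "\<dots> = DIM('a) * (- ln \<sigma> - ln (2 * pi) / 2) - (\<Sum>b\<in>Basis. ((x - m) \<bullet> b)\<^sup>2) / (2 * \<sigma>\<^sup>2)"
      by (simp add: sum_subtractf sum_divide_distrib)
    also have "(\<Sum>b\<in>Basis. ((x - m) \<bullet> b)\<^sup>2) = (norm (x - m))\<^sup>2"
      by (rule sum_Basis_inner_sq)
    finally show ?thesis .
  qed
  have eq: "ln (?g m \<sigma> x / ?g m' \<tau> x) =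
      DIM('a) * ln (\<tau> / \<sigma>) - (norm (x - m))\<^sup>2 / (2 * \<sigma>\<^sup>2) + (norm (x - m'))\<^sup>2 / (2 * \<tau>\<^sup>2)" for x
    unfolding ln_divide_pos[OF g_pos[OF \<sigma>] g_pos[OF \<tau>]] ln_g[OF \<sigma>] ln_g[OF \<tau>]
    using \<sigma> \<tau> by (simp add: ln_divide_pos algebra_simps)
  have i1: "has_bochner_integral (iso_gaussian m \<sigma>) (\<lambda>x. DIM('a) * ln (\<tau> / \<sigma>)) (DIM('a) * ln (\<tau> / \<sigma>))"
    by (simp add: has_bochner_integral_iff G.prob_space[unfolded space_iso_gaussian])
  have "has_bochner_integral (iso_gaussian m \<sigma>) (\<lambda>x. ln (?g m \<sigma> x / ?g m' \<tau> x))
     (DIM('a) * ln (\<tau> / \<sigma>) - (DIM('a) * \<sigma>\<^sup>2 + (norm (m - m))\<^sup>2) / (2 * \<sigma>\<^sup>2) +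
      (DIM('a) * \<sigma>\<^sup>2 + (norm (m - m'))\<^sup>2) / (2 * \<tau>\<^sup>2))"
    unfolding eq
    by (intro has_bochner_integral_add has_bochner_integral_diff has_bochner_integral_divide_zero
        i1 iso_gaussian_norm_moment \<sigma>)
  moreover have "DIM('a) * ln (\<tau> / \<sigma>) - (DIM('a) * \<sigma>\<^sup>2 + (norm (m - m))\<^sup>2) / (2 * \<sigma>\<^sup>2) +
      (DIM('a) * \<sigma>\<^sup>2 + (norm (m - m'))\<^sup>2) / (2 * \<tau>\<^sup>2) =
      DIM('a) * (ln (\<tau> / \<sigma>) + \<sigma>\<^sup>2 / (2 * \<tau>\<^sup>2) - 1 / 2) + (norm (m - m'))\<^sup>2 / (2 * \<tau>\<^sup>2)"
    using \<sigma> by (simp add: add_divide_distrib algebra_simps)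
  ultimately have "has_bochner_integral (iso_gaussian m \<sigma>) (\<lambda>x. ln (?g m \<sigma> x / ?g m' \<tau> x))
     (DIM('a) * (ln (\<tau> / \<sigma>) + \<sigma>\<^sup>2 / (2 * \<tau>\<^sup>2) - 1 / 2) + (norm (m - m'))\<^sup>2 / (2 * \<tau>\<^sup>2))"
    by simp
  then have int: "integrable (iso_gaussian m \<sigma>) (\<lambda>x. ln (?g m \<sigma> x / ?g m' \<tau> x))"
    and eq': "(\<integral>x. ln (?g m \<sigma> x / ?g m' \<tau> x) \<partial>iso_gaussian m \<sigma>) =
      DIM('a) * (ln (\<tau> / \<sigma>) + \<sigma>\<^sup>2 / (2 * \<tau>\<^sup>2) - 1 / 2) + (norm (m - m'))\<^sup>2 / (2 * \<tau>\<^sup>2)"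
    by (simp_all only: has_bochner_integral_iff)
  have g_meas: "?g m \<sigma> \<in> borel_measurable lborel" for m :: 'a and \<sigma>
    by measurable
  show ?thesis
    unfolding eq'[symmetric] using int unfolding iso_gaussian_def
    by (rule KL_density_density[OF lborel.sigma_finite_measure_axioms g_meas g_meas
        g_pos[OF \<tau>] less_imp_le[OF g_pos[OF \<sigma>]]])
qed

section \<open>Strictly positive dominated models: Hellinger integrals and the variational
  bound\<close>

section \<open>Dominated models\<close>

text \<open>Weighted arithmetic-geometric mean inequality, by convexity of \<open>exp\<close>
  between \<open>ln b\<close> and \<open>ln a\<close>.\<close>

lemma powr_mult_powr_le_convex:
  fixes a b :: real
  assumes "0 < a" "0 < b" "0 \<le> \<alpha>" "\<alpha> \<le> 1"
  shows "a powr \<alpha> * b powr (1 - \<alpha>) \<le> \<alpha> * a + (1 - \<alpha>) * b"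
proof -
  have "exp ((1 - \<alpha>) *\<^sub>R ln b + \<alpha> *\<^sub>R ln a) \<le> (1 - \<alpha>) * exp (ln b) + \<alpha> * exp (ln a)"
    using assms by (intro convex_onD[OF exp_convex]) auto
  then show ?thesis
    using assms by (simp add: powr_def flip: exp_add) (simp add: algebra_simps)
qed

lemma nn_integral_pos:
  assumes "f \<in> borel_measurable M" "\<And>x. x \<in> space M \<Longrightarrow> 0 < f x" "emeasure M (space M) \<noteq> 0"
  shows "0 < (\<integral>\<^sup>+x. f x \<partial>M)"
proof (rule ccontr)
  assume "\<not> 0 < (\<integral>\<^sup>+x. f x \<partial>M)"
  then have "AE x in M. f x = 0"
    using assms(1) by (simp add: nn_integral_0_iff_AE)
  then have "AE x in M. False"
    using AE_space by eventually_elim (use assms(2) in force)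
  then show False
    using assms(3) emeasure_eq_0_AE[of "\<lambda>_. True" M] by simp
qed

text \<open>Strict positivity of the densities keeps log-likelihood ratios meaningful at every point
  and Hellinger integrals nonzero. Joint measurability in parameter and observation is what Fubini
  requires.\<close>

locale dominated_model = sigma_finite_measure \<mu>
  for \<mu> :: "'x measure" +
  fixes T :: "'t measure" and p :: "'t \<Rightarrow> 'x \<Rightarrow> real"
  assumes p_measurable [measurable]: "(\<lambda>(\<theta>, x). p \<theta> x) \<in> borel_measurable (T \<Otimes>\<^sub>M \<mu>)"
    and p_pos: "\<theta> \<in> space T \<Longrightarrow> x \<in> space \<mu> \<Longrightarrow> 0 < p \<theta> x"
    and p_prob: "\<theta> \<in> space T \<Longrightarrow> prob_space (density \<mu> (\<lambda>x. ennreal (p \<theta> x)))"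
begin

definition law :: "'t \<Rightarrow> 'x measure" where
  "law \<theta> = density \<mu> (\<lambda>x. ennreal (p \<theta> x))"

definition sample :: "nat \<Rightarrow> 't \<Rightarrow> (nat \<Rightarrow> 'x) measure" where
  "sample n \<theta> = PiM {1..n} (\<lambda>i. law \<theta>)"

text \<open>The Hellinger integral of \<open>law \<theta>\<close> and \<open>law \<theta>'\<close>
  through the given densities; \<open>renyi_div_law\<close> links it to the Radon-Nikodym
  derivatives of the official definition.\<close>

definition hell :: "real \<Rightarrow> 't \<Rightarrow> 't \<Rightarrow> ennreal" where
  "hell \<alpha> \<theta> \<theta>' = (\<integral>\<^sup>+x. ennreal (p \<theta> x powr \<alpha> * p \<theta>' x powr (1 - \<alpha>)) \<partial>\<mu>)"

lemma sets_law [simp, measurable_cong]: "sets (law \<theta>) = sets \<mu>"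
  by (simp add: law_def)

lemma space_law [simp]: "space (law \<theta>) = space \<mu>"
  by (simp add: law_def)

lemma prob_space_law: "\<theta> \<in> space T \<Longrightarrow> prob_space (law \<theta>)"
  unfolding law_def by (rule p_prob)

lemma prob_space_sample: "\<theta> \<in> space T \<Longrightarrow> prob_space (sample n \<theta>)"
  unfolding sample_def by (intro prob_space_PiM prob_space_law)

lemma p_measurable_snd [measurable]: "\<theta> \<in> space T \<Longrightarrow> p \<theta> \<in> borel_measurable \<mu>"
  using measurable_compose[OF measurable_Pair1' p_measurable] by simp

lemma nn_integral_p: "\<theta> \<in> space T \<Longrightarrow> (\<integral>\<^sup>+x. ennreal (p \<theta> x) \<partial>\<mu>) = 1"
  using prob_space.emeasure_space_1[OF p_prob, of \<theta>] by (simp add: emeasure_density cong: nn_integral_cong)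

lemma space_in_sample: "x \<in> space (sample n \<theta>) \<Longrightarrow> i \<in> {1..n} \<Longrightarrow> x i \<in> space \<mu>"
  by (auto simp: sample_def space_PiM PiE_iff)

text \<open>A law dominated by the zero measure would have total mass 0. This makes integrals of
  positive functions positive in \<open>hell_bounds\<close>.\<close>

lemma emeasure_space_nonzero:
  assumes "\<theta> \<in> space T"
  shows "emeasure \<mu> (space \<mu>) \<noteq> 0"
proof
  assume "emeasure \<mu> (space \<mu>) = 0"
  then have "space \<mu> \<in> null_sets \<mu>" by auto
  moreover have "absolutely_continuous \<mu> (law \<theta>)"
    unfolding law_def using assms by (intro absolutely_continuousI_density) measurable
  ultimately have "emeasure (law \<theta>) (space (law \<theta>)) = 0"
    by (auto simp: absolutely_continuous_def)
  then show False
    using prob_space.emeasure_space_1[OF prob_space_law[OF assms]] by simp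
qed

text \<open>The integrand is positive on a space of nonzero measure, and the weighted mean
  inequality bounds it by a convex combination of two densities, each of integral 1. Consequently
  \<open>- ln\<close> of the Hellinger integral is finite and nonnegative.\<close>

lemma hell_bounds:
  assumes \<theta>: "\<theta> \<in> space T" "\<theta>' \<in> space T" and \<alpha>: "0 \<le> \<alpha>" "\<alpha> \<le> 1"
  shows "0 < hell \<alpha> \<theta> \<theta>'" "hell \<alpha> \<theta> \<theta>' \<le> 1"
proof -
  note [measurable] = \<theta>
  show "0 < hell \<alpha> \<theta> \<theta>'"
    unfolding hell_def
  proof (rule nn_integral_pos[OF _ _ emeasure_space_nonzero[OF \<theta>(1)]])
    fix x assume "x \<in> space \<mu>"
    then have "0 < p \<theta> x" "0 < p \<theta>' x" using \<theta> by (auto intro: p_pos)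
    then show "0 < ennreal (p \<theta> x powr \<alpha> * p \<theta>' x powr (1 - \<alpha>))" by simp
  qed measurable
  have "hell \<alpha> \<theta> \<theta>' \<le> (\<integral>\<^sup>+x. ennreal \<alpha> * ennreal (p \<theta> x) + ennreal (1 - \<alpha>) * ennreal (p \<theta>' x) \<partial>\<mu>)"
    unfolding hell_def
  proof (rule nn_integral_mono)
    fix x assume x: "x \<in> space \<mu>"
    have "ennreal (p \<theta> x powr \<alpha> * p \<theta>' x powr (1 - \<alpha>)) \<le> ennreal (\<alpha> * p \<theta> x + (1 - \<alpha>) * p \<theta>' x)"
      using x \<theta> \<alpha> by (intro ennreal_leI powr_mult_powr_le_convex p_pos)
    also have "\<dots> = ennreal \<alpha> * ennreal (p \<theta> x) + ennreal (1 - \<alpha>) * ennreal (p \<theta>' x)"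
      using \<alpha> p_pos[OF \<theta>(1) x] p_pos[OF \<theta>(2) x] by (simp add: ennreal_mult)
    finally show "ennreal (p \<theta> x powr \<alpha> * p \<theta>' x powr (1 - \<alpha>)) \<le>
        ennreal \<alpha> * ennreal (p \<theta> x) + ennreal (1 - \<alpha>) * ennreal (p \<theta>' x)" .
  qed
  also have "\<dots> = ennreal \<alpha> + ennreal (1 - \<alpha>)"
    by (simp add: nn_integral_add nn_integral_cmult nn_integral_p \<theta>)
  also have "\<dots> = 1"
    using \<alpha> by (simp flip: ennreal_plus)
  finally show "hell \<alpha> \<theta> \<theta>' \<le> 1" .
qed

lemma hell_eq_ennreal:
  assumes "\<theta> \<in> space T" "\<theta>' \<in> space T" "0 \<le> \<alpha>" "\<alpha> \<le> 1"
  obtains r where "hell \<alpha> \<theta> \<theta>' = ennreal r" "0 < r" "r \<le> 1"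
proof -
  obtain r where "hell \<alpha> \<theta> \<theta>' = ennreal r" "0 \<le> r"
    using hell_bounds(2)[OF assms] by (cases "hell \<alpha> \<theta> \<theta>'") (auto simp: top_unique)
  then show thesis
    using hell_bounds[OF assms] by (intro that[of r]) auto
qed

text \<open>The densities are versions of the Radon-Nikodym derivatives, and
  \<open>renyi_div_eq\<close> allows \<open>\<mu>\<close> as dominating measure. Positivity of
  \<open>hell\<close> rules out the branch for singular laws.\<close>

lemma renyi_div_law:
  assumes \<theta>: "\<theta> \<in> space T" "\<theta>' \<in> space T" and \<alpha>: "0 \<le> \<alpha>" "\<alpha> \<le> 1"
  shows "renyi_div \<alpha> (law \<theta>) (law \<theta>') = ennreal (1 / (\<alpha> - 1) * ln (enn2real (hell \<alpha> \<theta> \<theta>')))"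
proof -
  note [measurable] = \<theta>
  have rn: "AE x in \<mu>. ennreal (p \<theta> x) = RN_deriv \<mu> (law \<theta>) x" if "\<theta> \<in> space T" for \<theta>
    using that by (intro RN_deriv_unique) (auto simp: law_def)
  have "AE x in \<mu>. ennreal (enn2real (RN_deriv \<mu> (law \<theta>) x) powr \<alpha> *
      enn2real (RN_deriv \<mu> (law \<theta>') x) powr (1 - \<alpha>)) = ennreal (p \<theta> x powr \<alpha> * p \<theta>' x powr (1 - \<alpha>))"
    using rn[OF \<theta>(1)] rn[OF \<theta>(2)] AE_space
  proof eventually_elim
    case (elim x)
    show ?case
      unfolding elim(1,2)[symmetric] using p_pos[OF _ elim(3)] \<theta> by (simp add: less_imp_le)
  qed
  then have "hellinger_integral \<alpha> \<mu> (law \<theta>) (law \<theta>') = hell \<alpha> \<theta> \<theta>'"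
    unfolding hellinger_integral_def hell_def by (rule nn_integral_cong_AE)
  moreover have "finite_measure (law \<theta>)" "finite_measure (law \<theta>')"
    using \<theta> prob_space_law by (auto intro: prob_space.finite_measure)
  moreover have "absolutely_continuous \<mu> (law \<theta>)" "absolutely_continuous \<mu> (law \<theta>')"
    unfolding law_def by (rule absolutely_continuousI_density; measurable)+
  ultimately show ?thesis
    using hell_bounds(1)[OF \<theta> \<alpha>] sigma_finite_measure_axioms
    by (subst renyi_div_eq[of \<mu>]) (auto simp: renyi_value_def)
qed

section \<open>Likelihood ratios of a sample and their exponential moments\<close>

lemma log_ratio_measurable [measurable]:
  assumes [measurable]: "\<theta>0 \<in> space T"
  shows "(\<lambda>(\<theta>, x). log_ratio p n x \<theta> \<theta>0) \<in> borel_measurable (T \<Otimes>\<^sub>M sample n \<theta>')"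
proof -
  have c: "(\<lambda>z. snd z i) \<in> measurable (T \<Otimes>\<^sub>M sample n \<theta>') \<mu>" if "i \<in> {1..n}" for i
    using measurable_compose[OF measurable_snd, of "\<lambda>x. x i" "sample n \<theta>'" \<mu> T] that
    by (simp add: sample_def measurable_cong_sets[OF refl sets_law, symmetric])
  have a: "(\<lambda>z. p \<theta>0 (snd z i)) \<in> borel_measurable (T \<Otimes>\<^sub>M sample n \<theta>')" if "i \<in> {1..n}" for i
    by (rule measurable_compose[OF c[OF that] p_measurable_snd]) fact
  have b: "(\<lambda>z. p (fst z) (snd z i)) \<in> borel_measurable (T \<Otimes>\<^sub>M sample n \<theta>')" if "i \<in> {1..n}" for i
    using measurable_compose[OF measurable_Pair[OF measurable_fst c[OF that]] p_measurable] by simp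
  show ?thesis
    unfolding log_ratio_def split_beta by (intro borel_measurable_sum borel_measurable_ln borel_measurable_divide a b)
qed

text \<open>\<open>log_ratio\<close> has \<theta>0 in the numerator, so the factor -\<alpha> inverts
  each quotient.\<close>

lemma exp_log_ratio:
  assumes "\<theta> \<in> space T" "\<theta>0 \<in> space T" "x \<in> space (sample n \<theta>')"
  shows "exp (- \<alpha> * log_ratio p n x \<theta> \<theta>0) = (\<Prod>i=1..n. (p \<theta> (x i) / p \<theta>0 (x i)) powr \<alpha>)"
proof -
  have "- \<alpha> * log_ratio p n x \<theta> \<theta>0 = (\<Sum>i=1..n. \<alpha> * ln (p \<theta> (x i) / p \<theta>0 (x i)))"
    unfolding log_ratio_def sum_distrib_left
  proof (rule sum.cong[OF refl])
    fix i assume "i \<in> {1..n}"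
    then have "x i \<in> space \<mu>" using assms(3) by (rule space_in_sample[rotated])
    then have "0 < p \<theta> (x i)" "0 < p \<theta>0 (x i)" using assms by (auto intro: p_pos)
    then show "- \<alpha> * ln (p \<theta>0 (x i) / p \<theta> (x i)) = \<alpha> * ln (p \<theta> (x i) / p \<theta>0 (x i))"
      by (simp add: ln_divide_pos algebra_simps)
  qed
  also have "exp \<dots> = (\<Prod>i=1..n. (p \<theta> (x i) / p \<theta>0 (x i)) powr \<alpha>)"
    unfolding exp_sum[OF finite_atLeastAtMost]
  proof (rule prod.cong[OF refl])
    fix i assume "i \<in> {1..n}"
    then have "x i \<in> space \<mu>" using assms(3) by (rule space_in_sample[rotated])
    then have "0 < p \<theta> (x i)" "0 < p \<theta>0 (x i)" using assms by (auto intro: p_pos)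
    then show "exp (\<alpha> * ln (p \<theta> (x i) / p \<theta>0 (x i))) = (p \<theta> (x i) / p \<theta>0 (x i)) powr \<alpha>"
      by (simp add: powr_def)
  qed
  finally show ?thesis .
qed

text \<open>The observations are independent, so the expectation is a power. In one factor the
  density of the true law absorbs the denominator, and the Hellinger integrand remains.\<close>

lemma exp_moment_log_ratio:
  assumes \<theta>: "\<theta> \<in> space T" "\<theta>0 \<in> space T"
  shows "(\<integral>\<^sup>+x. ennreal (exp (- \<alpha> * log_ratio p n x \<theta> \<theta>0)) \<partial>sample n \<theta>0) = hell \<alpha> \<theta> \<theta>0 ^ n"
proof -
  note [measurable] = \<theta>
  let ?q = "\<lambda>x. ennreal ((p \<theta> x / p \<theta>0 x) powr \<alpha>)"
  interpret product_sigma_finite "\<lambda>i::nat. law \<theta>0"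
    by (rule product_sigma_finite.intro) (rule prob_space_imp_sigma_finite[OF prob_space_law[OF \<theta>(2)]])
  have "(\<integral>\<^sup>+x. ?q x \<partial>law \<theta>0) = (\<integral>\<^sup>+x. ennreal (p \<theta>0 x) * ?q x \<partial>\<mu>)"
    unfolding law_def by (rule nn_integral_density) measurable
  also have "\<dots> = hell \<alpha> \<theta> \<theta>0"
    unfolding hell_def
  proof (rule nn_integral_cong)
    fix x assume "x \<in> space \<mu>"
    then have pos: "0 < p \<theta> x" "0 < p \<theta>0 x" using \<theta> by (auto intro: p_pos)
    then have "p \<theta>0 x * (p \<theta> x / p \<theta>0 x) powr \<alpha> = p \<theta> x powr \<alpha> * p \<theta>0 x powr (1 - \<alpha>)"
      by (simp add: powr_divide powr_diff)
    with pos show "ennreal (p \<theta>0 x) * ?q x = ennreal (p \<theta> x powr \<alpha> * p \<theta>0 x powr (1 - \<alpha>))"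
      by (simp flip: ennreal_mult')
  qed
  finally have 1: "(\<integral>\<^sup>+x. ?q x \<partial>law \<theta>0) = hell \<alpha> \<theta> \<theta>0" .
  have "(\<integral>\<^sup>+x. ennreal (exp (- \<alpha> * log_ratio p n x \<theta> \<theta>0)) \<partial>sample n \<theta>0) =
      (\<integral>\<^sup>+x. (\<Prod>i=1..n. ?q (x i)) \<partial>sample n \<theta>0)"
    by (intro nn_integral_cong, subst exp_log_ratio[OF \<theta>], assumption, subst prod_ennreal) auto
  also have "\<dots> = (\<Prod>i=1..n. \<integral>\<^sup>+x. ?q x \<partial>law \<theta>0)"
    unfolding sample_def by (rule product_nn_integral_prod) auto
  finally show ?thesis by (simp add: 1)
qed

text \<open>For 0 < \<alpha> < 1 and \<theta>, \<theta>0 in the parameter space, the first part of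
  the exponent is \<open>n * (1 - \<alpha>)\<close> times the Renyi divergence. It is the
  normalisation under which the integrand has expectation 1 for each such \<theta>.\<close>

definition pac_moment :: "'t measure \<Rightarrow> real \<Rightarrow> 't \<Rightarrow> nat \<Rightarrow> (nat \<Rightarrow> 'x) \<Rightarrow> ennreal" where
  "pac_moment \<pi> \<alpha> \<theta>0 n x =
    (\<integral>\<^sup>+\<theta>. ennreal (exp (- real n * ln (enn2real (hell \<alpha> \<theta> \<theta>0)) - \<alpha> * log_ratio p n x \<theta> \<theta>0)) \<partial>\<pi>)"

lemma hell_measurable [measurable]:
  assumes [measurable]: "\<theta>0 \<in> space T"
  shows "(\<lambda>\<theta>. hell \<alpha> \<theta> \<theta>0) \<in> borel_measurable T"
  unfolding hell_def by measurable

lemma pac_integrand_measurable: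
  assumes [measurable]: "\<theta>0 \<in> space T"
  shows "(\<lambda>(\<theta>, x). ennreal (exp (- real n * ln (enn2real (hell \<alpha> \<theta> \<theta>0)) - \<alpha> * log_ratio p n x \<theta> \<theta>0)))
    \<in> borel_measurable (T \<Otimes>\<^sub>M sample n \<theta>')"
  by measurable

lemma pac_moment_measurable:
  assumes \<theta>0: "\<theta>0 \<in> space T" and \<pi>: "sigma_finite_measure \<pi>" "sets \<pi> = sets T"
  shows "pac_moment \<pi> \<alpha> \<theta>0 n \<in> borel_measurable (sample n \<theta>')"
proof -
  interpret \<pi>: sigma_finite_measure \<pi> by fact
  have "(\<lambda>(x, \<theta>). ennreal (exp (- real n * ln (enn2real (hell \<alpha> \<theta> \<theta>0)) - \<alpha> * log_ratio p n x \<theta> \<theta>0)))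
    \<in> borel_measurable (sample n \<theta>' \<Otimes>\<^sub>M T)"
    using measurable_pair_swap[OF pac_integrand_measurable[OF \<theta>0]] by (simp add: split_beta')
  then show ?thesis
    unfolding pac_moment_def[abs_def]
    by (intro \<pi>.borel_measurable_nn_integral) (simp add: measurable_cong_sets[OF sets_pair_measure_cong[OF refl \<pi>(2)] refl])
qed

text \<open>After exchanging the integrals, the factor \<open>exp (- n * ln r)\<close> cancels the
  \<open>n\<close>-th power of the Hellinger integral \<open>r\<close> for each parameter
  separately.\<close>

lemma nn_integral_pac_moment:
  assumes \<theta>0: "\<theta>0 \<in> space T" and \<alpha>: "0 \<le> \<alpha>" "\<alpha> \<le> 1"
    and \<pi>: "prob_space \<pi>" "sets \<pi> = sets T"
  shows "(\<integral>\<^sup>+x. pac_moment \<pi> \<alpha> \<theta>0 n x \<partial>sample n \<theta>0) = 1"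
proof -
  interpret \<pi>: prob_space \<pi> by fact
  interpret S: prob_space "sample n \<theta>0" by (rule prob_space_sample[OF \<theta>0])
  interpret pair_sigma_finite \<pi> "sample n \<theta>0" ..
  let ?H = "\<lambda>\<theta>. enn2real (hell \<alpha> \<theta> \<theta>0)"
  have sp: "space \<pi> = space T" by (rule sets_eq_imp_space_eq[OF \<pi>(2)])
  have m: "(\<lambda>(\<theta>, x). ennreal (exp (- real n * ln (?H \<theta>) - \<alpha> * log_ratio p n x \<theta> \<theta>0)))
    \<in> borel_measurable (\<pi> \<Otimes>\<^sub>M sample n \<theta>0)"
    unfolding measurable_cong_sets[OF sets_pair_measure_cong[OF \<pi>(2) refl] refl]
    by (rule pac_integrand_measurable[OF \<theta>0])
  have "(\<integral>\<^sup>+x. pac_moment \<pi> \<alpha> \<theta>0 n x \<partial>sample n \<theta>0) =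
    (\<integral>\<^sup>+\<theta>. \<integral>\<^sup>+x. ennreal (exp (- real n * ln (?H \<theta>) - \<alpha> * log_ratio p n x \<theta> \<theta>0)) \<partial>sample n \<theta>0 \<partial>\<pi>)"
    unfolding pac_moment_def by (rule Fubini'[OF m])
  also have "\<dots> = (\<integral>\<^sup>+\<theta>. 1 \<partial>\<pi>)"
  proof (rule nn_integral_cong)
    fix \<theta> assume "\<theta> \<in> space \<pi>"
    then have \<theta>: "\<theta> \<in> space T" by (simp add: sp)
    obtain r where r: "hell \<alpha> \<theta> \<theta>0 = ennreal r" "0 < r"
      using hell_eq_ennreal[OF \<theta> \<theta>0 \<alpha>] .
    have "(\<lambda>x. exp (- \<alpha> * log_ratio p n x \<theta> \<theta>0)) \<in> borel_measurable (sample n \<theta>0)"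
      using measurable_compose[OF measurable_Pair1'[OF \<theta>] log_ratio_measurable[OF \<theta>0]] by simp
    then have "(\<integral>\<^sup>+x. ennreal (exp (- real n * ln (?H \<theta>) - \<alpha> * log_ratio p n x \<theta> \<theta>0)) \<partial>sample n \<theta>0) =
      ennreal (exp (- real n * ln r)) * (\<integral>\<^sup>+x. ennreal (exp (- \<alpha> * log_ratio p n x \<theta> \<theta>0)) \<partial>sample n \<theta>0)"
      using r by (subst nn_integral_cmult[symmetric]) (auto simp: exp_diff exp_minus field_simps simp flip: ennreal_mult')
    also have "\<dots> = ennreal (exp (- real n * ln r) * r ^ n)"
      unfolding exp_moment_log_ratio[OF \<theta> \<theta>0] r(1) using r(2) by (simp add: ennreal_power ennreal_mult)
    also have "exp (- real n * ln r) * r ^ n = 1"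
      using r(2) by (simp add: exp_minus exp_of_nat_mult)
    finally show "(\<integral>\<^sup>+x. ennreal (exp (- real n * ln (?H \<theta>) - \<alpha> * log_ratio p n x \<theta> \<theta>0)) \<partial>sample n \<theta>0) = 1"
      by simp
  qed
  also have "\<dots> = 1"
    by (simp add: \<pi>.emeasure_space_1)
  finally show ?thesis .
qed

section \<open>The bound at a fixed sample point and the probability of its hypothesis\<close>

lemma log_ratio_measurable_param:
  assumes "\<theta>0 \<in> space T" "x \<in> space (sample n \<theta>')"
  shows "(\<lambda>\<theta>. log_ratio p n x \<theta> \<theta>0) \<in> borel_measurable T"
  using measurable_compose[OF measurable_Pair2'[OF assms(2)] log_ratio_measurable[OF assms(1)]] by simp

text \<open>A deterministic statement about one sample point. Minimality compares
  \<open>\<rho>\<close> with \<open>\<rho>0\<close>, \<open>KL_tilted\<close> evaluates the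
  divergence of \<open>\<rho>0\<close> from the tempered posterior, and
  \<open>donsker_varadhan_le\<close> transfers the bound to the integral of
  \<open>h\<close>.\<close>

lemma variational_renyi_bound:
  fixes \<pi> \<rho> \<rho>0 :: "'t measure"
  assumes \<theta>0: "\<theta>0 \<in> space T" and x: "x \<in> space (sample n \<theta>')"
    and \<alpha>: "0 < \<alpha>" "\<alpha> < 1" and n: "1 \<le> n" and \<epsilon>: "0 < \<epsilon>"
    and \<pi>: "prob_space \<pi>" "sets \<pi> = sets T"
    and \<rho>: "prob_space \<rho>" "sets \<rho> = sets T"
    and \<rho>0: "prob_space \<rho>0" "sets \<rho>0 = sets T"
    and min: "KL \<rho> (tempered_posterior p \<pi> \<alpha> \<theta>0 n x) \<le> KL \<rho>0 (tempered_posterior p \<pi> \<alpha> \<theta>0 n x)"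
    and \<kappa>: "KL \<rho>0 \<pi> = ereal \<kappa>"
    and int: "integrable \<rho>0 (\<lambda>\<theta>. log_ratio p n x \<theta> \<theta>0)"
    and W: "pac_moment \<pi> \<alpha> \<theta>0 n x \<le> ennreal (1 / \<epsilon>)"
  shows "(\<integral>\<^sup>+\<theta>. renyi_div \<alpha> (law \<theta>) (law \<theta>0) \<partial>\<rho>) \<le>
    ennreal ((\<alpha> * (\<integral>\<theta>. log_ratio p n x \<theta> \<theta>0 \<partial>\<rho>0) + \<kappa> + ln (1 / \<epsilon>)) / (n * (1 - \<alpha>)))"
proof -
  interpret \<pi>: prob_space \<pi> by fact
  interpret \<rho>0: prob_space \<rho>0 by fact
  have \<alpha>': "0 \<le> \<alpha>" "\<alpha> \<le> 1" using \<alpha> by auto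
  have sp: "space \<pi> = space T" "space \<rho> = space T"
    by (rule sets_eq_imp_space_eq, fact)+
  let ?r = "\<lambda>\<theta>. log_ratio p n x \<theta> \<theta>0"
  define h where "h \<theta> = - real n * ln (enn2real (hell \<alpha> \<theta> \<theta>0))" for \<theta>
  have r_meas: "?r \<in> borel_measurable T"
    by (rule log_ratio_measurable_param[OF \<theta>0 x])
  have h_meas: "h \<in> borel_measurable T"
    using hell_measurable[OF \<theta>0] unfolding h_def by measurable
  have [measurable]: "?r \<in> borel_measurable \<pi>" "h \<in> borel_measurable \<pi>" "h \<in> borel_measurable \<rho>"
    using r_meas h_meas
    unfolding measurable_cong_sets[OF \<pi>(2) refl] measurable_cong_sets[OF \<rho>(2) refl] by blast+
  have h_nonneg: "0 \<le> h \<theta>" if \<theta>: "\<theta> \<in> space T" for \<theta>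
  proof -
    obtain r where "hell \<alpha> \<theta> \<theta>0 = ennreal r" "0 < r" "r \<le> 1"
      using hell_eq_ennreal[OF \<theta> \<theta>0 \<alpha>'] .
    then show ?thesis by (simp add: h_def mult_nonneg_nonpos)
  qed
  define Z where "Z = (\<integral>\<^sup>+\<theta>. ennreal (exp (- \<alpha> * ?r \<theta>)) \<partial>\<pi>)"
  \<comment> \<open>Since \<open>h\<close> is nonnegative, the bound on \<open>pac_moment\<close>
    also bounds the normalising constant, so the tempered posterior divides by a finite positive
    number.\<close>
  have "Z \<le> pac_moment \<pi> \<alpha> \<theta>0 n x"
    unfolding Z_def pac_moment_def
    by (intro nn_integral_mono ennreal_leI) (use h_nonneg in \<open>auto simp: sp h_def\<close>)
  then have "Z < top"
    by (rule order_le_less_trans[OF order_trans[OF _ W]]) simp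
  moreover have "0 < Z"
    unfolding Z_def by (intro nn_integral_pos) (auto simp: \<pi>.emeasure_space_1)
  ultimately obtain z where z: "Z = ennreal z" "0 < z"
    by (cases Z) auto
  define w where "w \<theta> = exp (- \<alpha> * ?r \<theta>) / z" for \<theta>
  have [measurable]: "w \<in> borel_measurable \<pi>"
    unfolding w_def by measurable
  have w_pos: "0 < w \<theta>" for \<theta>
    using z by (simp add: w_def)
  have post: "tempered_posterior p \<pi> \<alpha> \<theta>0 n x = density \<pi> (\<lambda>\<theta>. ennreal (w \<theta>))"
    unfolding tempered_posterior_def Z_def[symmetric] z(1) w_def using z(2) by (simp add: divide_ennreal)
  have ln_w: "ln (w \<theta>) = - \<alpha> * ?r \<theta> - ln z" for \<theta>
    using z(2) by (simp add: w_def ln_divide_pos)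
  let ?c = "\<kappa> + \<alpha> * (\<integral>\<theta>. ?r \<theta> \<partial>\<rho>0) + ln z"
  have "KL \<rho>0 (density \<pi> w) = ereal (\<kappa> - (\<integral>\<theta>. ln (w \<theta>) \<partial>\<rho>0))"
    using int by (intro KL_tilted \<pi>.sigma_finite_measure_axioms \<rho>0.sigma_finite_measure_axioms \<kappa> w_pos)
      (auto simp: \<pi> \<rho>0 ln_w)
  also have "(\<integral>\<theta>. ln (w \<theta>) \<partial>\<rho>0) = - \<alpha> * (\<integral>\<theta>. ?r \<theta> \<partial>\<rho>0) - ln z"
    unfolding ln_w using int by (simp add: \<rho>0.prob_space)
  finally have "KL \<rho> (density \<pi> w) \<le> ereal ?c"
    using min by (simp add: post algebra_simps)
  \<comment> \<open>Weighting by \<open>w\<close> turns the exponential moment of \<open>h\<close>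
    under the posterior into \<open>pac_moment\<close> divided by \<open>z\<close>.\<close>
  moreover have "(\<integral>\<^sup>+\<theta>. ennreal (exp (h \<theta>)) \<partial>density \<pi> w) \<le> ennreal (1 / \<epsilon> / z)"
  proof -
    have "(\<integral>\<^sup>+\<theta>. ennreal (exp (h \<theta>)) \<partial>density \<pi> w) = (\<integral>\<^sup>+\<theta>. ennreal (w \<theta>) * ennreal (exp (h \<theta>)) \<partial>\<pi>)"
      by (rule nn_integral_density) auto
    also have "\<dots> = (\<integral>\<^sup>+\<theta>. ennreal (exp (h \<theta> - \<alpha> * ?r \<theta>)) * ennreal (1 / z) \<partial>\<pi>)"
    proof (rule nn_integral_cong)
      fix \<theta>
      have "w \<theta> * exp (h \<theta>) = exp (h \<theta> - \<alpha> * ?r \<theta>) * (1 / z)"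
        by (simp add: w_def exp_diff exp_minus divide_simps)
      then show "ennreal (w \<theta>) * ennreal (exp (h \<theta>)) = ennreal (exp (h \<theta> - \<alpha> * ?r \<theta>)) * ennreal (1 / z)"
        using w_pos[of \<theta>] by (simp only: ennreal_mult'[symmetric] exp_ge_zero less_imp_le)
    qed
    also have "\<dots> = pac_moment \<pi> \<alpha> \<theta>0 n x * ennreal (1 / z)"
      unfolding pac_moment_def h_def[symmetric] by (rule nn_integral_multc) measurable
    also have "\<dots> \<le> ennreal (1 / \<epsilon>) * ennreal (1 / z)"
      by (intro mult_right_mono W) auto
    also have "\<dots> = ennreal (1 / \<epsilon> / z)"
      using \<epsilon> z(2) by (simp flip: ennreal_mult)
    finally show ?thesis .
  qed
  moreover have "sigma_finite_measure (density \<pi> w)"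
    using w_pos by (subst \<pi>.sigma_finite_iff_density_finite) auto
  ultimately have "(\<integral>\<^sup>+\<theta>. ennreal (h \<theta>) \<partial>\<rho>) \<le> ennreal (?c + ln (1 / \<epsilon> / z))"
    using \<epsilon> z(2) h_nonneg by (intro donsker_varadhan_le[OF \<rho>(1)]) (auto simp: \<rho> \<pi> sp)
  \<comment> \<open>The unknown \<open>ln z\<close> enters once through the divergence and once,
    with opposite sign, through the exponential moment.\<close>
  also have "?c + ln (1 / \<epsilon> / z) = \<alpha> * (\<integral>\<theta>. ?r \<theta> \<partial>\<rho>0) + \<kappa> + ln (1 / \<epsilon>)"
    using \<epsilon> z(2) by (subst ln_divide_pos) auto
  finally have bound: "(\<integral>\<^sup>+\<theta>. ennreal (h \<theta>) \<partial>\<rho>) \<le> ennreal (\<alpha> * (\<integral>\<theta>. ?r \<theta> \<partial>\<rho>0) + \<kappa> + ln (1 / \<epsilon>))" .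
  have "(\<integral>\<^sup>+\<theta>. renyi_div \<alpha> (law \<theta>) (law \<theta>0) \<partial>\<rho>) = (\<integral>\<^sup>+\<theta>. ennreal (h \<theta>) * ennreal (1 / (n * (1 - \<alpha>))) \<partial>\<rho>)"
  proof (rule nn_integral_cong)
    fix \<theta> assume "\<theta> \<in> space \<rho>"
    then have \<theta>: "\<theta> \<in> space T" by (simp add: sp)
    have "1 / (\<alpha> - 1) * ln (enn2real (hell \<alpha> \<theta> \<theta>0)) = h \<theta> * (1 / (n * (1 - \<alpha>)))"
      using n \<alpha> by (simp add: h_def divide_simps) (simp add: algebra_simps)
    then show "renyi_div \<alpha> (law \<theta>) (law \<theta>0) = ennreal (h \<theta>) * ennreal (1 / (n * (1 - \<alpha>)))"
      using h_nonneg[OF \<theta>] by (simp only: renyi_div_law[OF \<theta> \<theta>0 \<alpha>'] ennreal_mult')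
  qed
  also have "\<dots> = (\<integral>\<^sup>+\<theta>. ennreal (h \<theta>) \<partial>\<rho>) * ennreal (1 / (n * (1 - \<alpha>)))"
    by (rule nn_integral_multc) measurable
  also have "\<dots> \<le> ennreal (\<alpha> * (\<integral>\<theta>. ?r \<theta> \<partial>\<rho>0) + \<kappa> + ln (1 / \<epsilon>)) * ennreal (1 / (n * (1 - \<alpha>)))"
    by (intro mult_right_mono bound) auto
  also have "\<dots> = ennreal ((\<alpha> * (\<integral>\<theta>. ?r \<theta> \<partial>\<rho>0) + \<kappa> + ln (1 / \<epsilon>)) * (1 / (n * (1 - \<alpha>))))"
    \<comment> \<open>The first factor may have either sign; with a nonnegative second factor,
      \<open>ennreal\<close> truncates both sides alike.\<close>
    using \<alpha> by (intro ennreal_mult''[symmetric]) auto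
  finally show ?thesis by simp
qed

text \<open>Markov's inequality for a nonnegative variable of expectation 1.\<close>

lemma pac_moment_tail:
  assumes \<theta>0: "\<theta>0 \<in> space T" and \<alpha>: "0 \<le> \<alpha>" "\<alpha> \<le> 1"
    and \<pi>: "prob_space \<pi>" "sets \<pi> = sets T" and \<epsilon>: "0 < \<epsilon>"
  shows "{x \<in> space (sample n \<theta>0). pac_moment \<pi> \<alpha> \<theta>0 n x > ennreal (1 / \<epsilon>)} \<in> sets (sample n \<theta>0)"
    "measure (sample n \<theta>0) {x \<in> space (sample n \<theta>0). pac_moment \<pi> \<alpha> \<theta>0 n x > ennreal (1 / \<epsilon>)} \<le> \<epsilon>"
proof -
  interpret S: prob_space "sample n \<theta>0" by (rule prob_space_sample[OF \<theta>0])
  let ?W = "pac_moment \<pi> \<alpha> \<theta>0 n"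
  have [measurable]: "?W \<in> borel_measurable (sample n \<theta>0)"
    using \<pi> by (intro pac_moment_measurable \<theta>0 prob_space_imp_sigma_finite)
  show "{x \<in> space (sample n \<theta>0). ?W x > ennreal (1 / \<epsilon>)} \<in> sets (sample n \<theta>0)"
    by measurable
  have "emeasure (sample n \<theta>0) {x \<in> space (sample n \<theta>0). ?W x > ennreal (1 / \<epsilon>)} \<le>
      emeasure (sample n \<theta>0) {x \<in> space (sample n \<theta>0). 1 \<le> ennreal \<epsilon> * ?W x}"
  proof (intro emeasure_mono subsetI CollectI conjI)
    fix x assume "x \<in> {x \<in> space (sample n \<theta>0). ?W x > ennreal (1 / \<epsilon>)}"
    then have "ennreal \<epsilon> * ennreal (1 / \<epsilon>) \<le> ennreal \<epsilon> * ?W x"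
      by (intro mult_left_mono) auto
    then show "1 \<le> ennreal \<epsilon> * ?W x"
      using \<epsilon> by (simp flip: ennreal_mult)
  qed auto
  also have "\<dots> \<le> ennreal \<epsilon> * (\<integral>\<^sup>+x. ?W x * indicator (space (sample n \<theta>0)) x \<partial>sample n \<theta>0)"
    by (rule nn_integral_Markov_inequality) auto
  also have "(\<integral>\<^sup>+x. ?W x * indicator (space (sample n \<theta>0)) x \<partial>sample n \<theta>0) = (\<integral>\<^sup>+x. ?W x \<partial>sample n \<theta>0)"
    by (rule nn_integral_cong) simp
  also have "\<dots> = 1"
    by (rule nn_integral_pac_moment[OF \<theta>0 \<alpha> \<pi>])
  finally show "measure (sample n \<theta>0) {x \<in> space (sample n \<theta>0). ?W x > ennreal (1 / \<epsilon>)} \<le> \<epsilon>"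
    using \<epsilon> by (simp add: S.emeasure_eq_measure)
qed

end

section \<open>The logistic model: Lipschitz log-likelihood and averaged log-ratio\<close>

section \<open>Logistic regression\<close>

text \<open>The function is \<open>u - ln (1 + exp u)\<close>. For s \<le> t the subtracted
  logarithm grows by at least 0 and at most t - s, so the difference grows by an amount between the
  same limits.\<close>

lemma ln_sigmoid_lipschitz:
  fixes s t :: real
  shows "\<bar>ln (exp s / (1 + exp s)) - ln (exp t / (1 + exp t))\<bar> \<le> \<bar>s - t\<bar>"
proof (induction s t rule: linorder_wlog)
  case (le s t)
  have pos: "0 < 1 + exp u" for u :: real
    by (intro add_pos_pos) auto
  have eq: "ln (exp u / (1 + exp u)) = u - ln (1 + exp u)" for u :: real
    using pos[of u] by (simp add: ln_divide_pos)
  have "1 + exp t \<le> exp (t - s) * (1 + exp s)"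
    using le by (simp add: distrib_left flip: exp_add)
  then have "ln (1 + exp t) \<le> ln (exp (t - s) * (1 + exp s))"
    by (subst ln_le_cancel_iff) (auto intro: mult_pos_pos pos)
  also have "\<dots> = t - s + ln (1 + exp s)"
    using pos[of s] by (simp add: ln_mult)
  finally have "ln (1 + exp t) \<le> t - s + ln (1 + exp s)" .
  moreover have "ln (1 + exp s) \<le> ln (1 + exp t)"
    using le pos by (subst ln_le_cancel_iff) auto
  ultimately show ?case
    using le unfolding eq by simp
next
  case (sym s t)
  then show ?case by (simp add: abs_minus_commute)
qed

lemma logistic_prob_pos: "0 < logistic_prob \<theta> x"
  by (auto simp: logistic_prob_def split_beta intro!: divide_pos_pos add_pos_pos)

text \<open>The label has absolute value 1 and drops out of the Lipschitz bound, which leaves a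
  single direction \<open>z\<close>.\<close>

lemma abs_ln_logistic_ratio_le:
  assumes "y \<in> {-1, 1}"
  shows "\<bar>ln (logistic_prob \<theta>0 (y, z) / logistic_prob \<theta> (y, z))\<bar> \<le> \<bar>z \<bullet> (\<theta> - \<theta>0)\<bar>"
proof -
  have "\<bar>ln (logistic_prob \<theta>0 (y, z) / logistic_prob \<theta> (y, z))\<bar> =
      \<bar>ln (logistic_prob \<theta>0 (y, z)) - ln (logistic_prob \<theta> (y, z))\<bar>"
    by (simp add: ln_divide_pos logistic_prob_pos)
  also have "\<dots> \<le> \<bar>y * (z \<bullet> \<theta>0) - y * (z \<bullet> \<theta>)\<bar>"
    unfolding logistic_prob_def prod.case by (rule ln_sigmoid_lipschitz)
  also have "\<dots> = \<bar>z \<bullet> (\<theta> - \<theta>0)\<bar>"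
    using assms by (auto simp: inner_diff_right)
  finally show ?thesis .
qed

lemma logistic_prob_measurable_pair:
  fixes Q :: "'a::euclidean_space measure"
  assumes Q: "sets Q = sets borel"
  shows "(\<lambda>(\<theta>, x). logistic_prob \<theta> x) \<in> borel_measurable (borel \<Otimes>\<^sub>M (count_space {-1, 1} \<Otimes>\<^sub>M Q))"
proof -
  let ?M = "borel \<Otimes>\<^sub>M (count_space {-1, 1} \<Otimes>\<^sub>M Q) :: ('a \<times> real \<times> 'a) measure"
  have y: "(\<lambda>u. fst (snd u)) \<in> borel_measurable ?M"
    by (rule measurable_compose[OF measurable_snd measurable_compose[OF measurable_fst]]) simp
  have z: "(\<lambda>u. snd (snd u)) \<in> borel_measurable ?M"
    using measurable_compose[OF measurable_snd[of borel "count_space {-1, 1} \<Otimes>\<^sub>M Q"]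
        measurable_snd[of "count_space {-1, 1}" Q]]
    unfolding measurable_cong_sets[OF refl Q] .
  have t: "(\<lambda>u. exp (fst (snd u) * (snd (snd u) \<bullet> fst u))) \<in> borel_measurable ?M"
    by (intro measurable_compose[OF _ borel_measurable_exp] borel_measurable_times
        borel_measurable_inner y z measurable_fst)
  show ?thesis
    unfolding logistic_prob_def split_beta
    by (intro borel_measurable_divide borel_measurable_add borel_measurable_const t)
qed

text \<open>The design law is common to all parameters, so its product with counting measure on the
  labels dominates the whole model.\<close>

lemma dominated_model_logistic:
  assumes Q: "prob_space Q" "sets Q = sets borel"
  shows "dominated_model (count_space {-1, 1} \<Otimes>\<^sub>M Q) borel logistic_prob"
proof -
  interpret Q: prob_space Q by fact
  interpret C: sigma_finite_measure "count_space {-1, 1::real}"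
    by (rule sigma_finite_measure_count_space_finite) simp
  interpret pair_sigma_finite "count_space {-1, 1::real}" Q ..
  show ?thesis
    by (intro dominated_model.intro dominated_model_axioms.intro sigma_finite_measure_axioms
        logistic_prob_measurable_pair[OF Q(2)] logistic_prob_pos
        prob_space_logistic_law[OF Q, unfolded logistic_law_def])
qed

text \<open>The contribution of one observation to the \<open>\<rho>\<close>-average of
  \<open>log_ratio\<close>. Averaging over the parameter first makes that average a sum of i.i.d.
  terms.\<close>

definition mean_log_ratio :: "'a::euclidean_space measure \<Rightarrow> 'a \<Rightarrow> real \<times> 'a \<Rightarrow> real" where
  "mean_log_ratio \<rho> \<theta>0 x = (\<integral>\<theta>. ln (logistic_prob \<theta>0 x / logistic_prob \<theta> x) \<partial>\<rho>)"

text \<open>The Lipschitz bound reduces both claims to the absolute moment of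
  \<open>z \<bullet> (\<theta> - \<theta>0)\<close>.\<close>

lemma mean_log_ratio_iso_gaussian:
  assumes y: "y \<in> {-1, 1}" and \<sigma>: "0 < \<sigma>"
  shows "integrable (iso_gaussian \<theta>0 \<sigma>) (\<lambda>\<theta>. ln (logistic_prob \<theta>0 (y, z) / logistic_prob \<theta> (y, z)))"
    "\<bar>mean_log_ratio (iso_gaussian \<theta>0 \<sigma>) \<theta>0 (y, z)\<bar> \<le> \<sigma> * norm z"
proof -
  let ?G = "iso_gaussian \<theta>0 \<sigma>"
  let ?l = "\<lambda>\<theta>. ln (logistic_prob \<theta>0 (y, z) / logistic_prob \<theta> (y, z))"
  note i = integrable_abs[OF iso_gaussian_abs_moment(1)[OF \<sigma>, of \<theta>0 z]]
  have "?l \<in> borel_measurable ?G"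
    unfolding measurable_cong_sets[OF sets_iso_gaussian refl] logistic_prob_def prod.case by measurable
  then show l: "integrable ?G ?l"
    by (rule Bochner_Integration.integrable_bound[OF i])
      (use abs_ln_logistic_ratio_le[OF y] in auto)
  have "\<bar>\<integral>\<theta>. ?l \<theta> \<partial>?G\<bar> \<le> (\<integral>\<theta>. \<bar>?l \<theta>\<bar> \<partial>?G)"
    by (rule integral_abs_bound)
  also have "\<dots> \<le> (\<integral>\<theta>. \<bar>z \<bullet> (\<theta> - \<theta>0)\<bar> \<partial>?G)"
    using l i by (intro integral_mono abs_ln_logistic_ratio_le[OF y]) auto
  also have "\<dots> \<le> \<sigma> * norm z"
    by (rule iso_gaussian_abs_moment(2)[OF \<sigma>])
  finally show "\<bar>mean_log_ratio ?G \<theta>0 (y, z)\<bar> \<le> \<sigma> * norm z"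
    by (simp add: mean_log_ratio_def)
qed

lemma mean_log_ratio_measurable:
  assumes Q: "sets Q = sets borel" and \<rho>: "prob_space \<rho>" "sets \<rho> = sets borel"
  shows "mean_log_ratio \<rho> \<theta>0 \<in> borel_measurable (count_space {-1, 1} \<Otimes>\<^sub>M Q)"
proof -
  interpret \<rho>: prob_space \<rho> by fact
  let ?M = "count_space {-1, 1} \<Otimes>\<^sub>M Q"
  have "(\<lambda>(x, \<theta>). logistic_prob \<theta> x) \<in> borel_measurable (?M \<Otimes>\<^sub>M borel)"
    using measurable_pair_swap[OF logistic_prob_measurable_pair[OF Q]] by (simp add: split_beta')
  then have "(\<lambda>(x, \<theta>). ln (logistic_prob \<theta>0 x / logistic_prob \<theta> x)) \<in> borel_measurable (?M \<Otimes>\<^sub>M borel)"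
    using measurable_compose[OF measurable_fst logistic_prob_measurable[OF Q, of \<theta>0], of "borel"]
    unfolding split_beta by (intro borel_measurable_ln borel_measurable_divide)
  then have "(\<lambda>(x, \<theta>). ln (logistic_prob \<theta>0 x / logistic_prob \<theta> x)) \<in> borel_measurable (?M \<Otimes>\<^sub>M \<rho>)"
    unfolding measurable_cong_sets[OF sets_pair_measure_cong[OF refl \<rho>(2)] refl] .
  then show ?thesis
    unfolding mean_log_ratio_def[abs_def] by (rule \<rho>.borel_measurable_lebesgue_integral)
qed

theorem corollary3p3:
  fixes Q :: "(real ^ 'd) measure"
    and \<theta>0 :: "real ^ 'd"
    and \<F> :: "(real ^ 'd) measure set"
    and post_var :: "(nat \<Rightarrow> real \<times> (real ^ 'd)) \<Rightarrow> (real ^ 'd) measure"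
    and n :: nat
    and \<tau> \<alpha> \<eta> \<epsilon> K1 K2 \<epsilon>n :: real
    and \<P> :: "(nat \<Rightarrow> real \<times> (real ^ 'd)) measure"
  assumes n: "n \<ge> 1"
    and design: "Q \<in> space (prob_algebra borel)"
    and sample_law: "\<P> = PiM {1..n} (\<lambda>i. logistic_law Q \<theta>0)"
    and prior_sd: "\<tau> > 0"
    and family: "\<F> \<subseteq> space (prob_algebra borel)"
    and family_gaussian: "{iso_gaussian m \<sigma> | m \<sigma>. \<sigma> > 0} \<subseteq> \<F>"
    and variational: "\<And>x. x \<in> space \<P> \<Longrightarrow>
          is_arg_min
            (\<lambda>\<rho>. KL \<rho> (tempered_posterior logistic_prob (iso_gaussian 0 \<tau>) \<alpha> \<theta>0 n x))
            (\<lambda>\<rho>. \<rho> \<in> \<F>)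
            (post_var x)"
    and K1_finite: "integrable \<P> (\<lambda>x. norm (snd (x 1)))"
    and K2_finite: "integrable \<P> (\<lambda>x. (norm (snd (x 1)))\<^sup>2)"
    and K1: "K1 = 2 * (\<integral>x. norm (snd (x 1)) \<partial>\<P>)"
    and K2: "K2 = 4 * (\<integral>x. (norm (snd (x 1)))\<^sup>2 \<partial>\<P>)"
    and rate: "\<epsilon>n = max (K1 / n) (max (K2 / n\<^sup>2)
          (CARD('d) / n * (1 / 2 * ln (\<tau>\<^sup>2 * n\<^sup>2 * sqrt CARD('d)) + 1 / (n * \<tau>\<^sup>2))
            + (norm \<theta>0)\<^sup>2 / (n * \<tau>\<^sup>2) - CARD('d) / (2 * n)))"
    and \<alpha>: "0 < \<alpha>" "\<alpha> < 1"
    and \<eta>: "0 < \<eta>" "\<eta> < 1"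
    and \<epsilon>: "0 < \<epsilon>" "\<epsilon> < 1"
  shows "inner_prob \<P> {x \<in> space \<P>.
            (\<integral>\<^sup>+\<theta>. renyi_div \<alpha> (logistic_law Q \<theta>) (logistic_law Q \<theta>0) \<partial>post_var x)
              \<le> ennreal (((\<alpha> + 1) * \<epsilon>n + \<alpha> * sqrt (\<epsilon>n / (n * \<eta>)) + ln (1 / \<epsilon>) / n) / (1 - \<alpha>))}
         \<ge> 1 - \<epsilon> - \<eta>"
proof -
  have Q: "prob_space Q" "sets Q = sets borel"
    using design by (auto simp: space_prob_algebra)
  define \<mu> where "\<mu> = count_space {-1, 1::real} \<Otimes>\<^sub>M Q"
  interpret dominated_model \<mu> borel "logistic_prob :: real ^ 'd \<Rightarrow> _"
    unfolding \<mu>_def by (rule dominated_model_logistic[OF Q])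
  have law_eq: "law \<theta> = logistic_law Q \<theta>" for \<theta>
    unfolding law_def unfolding logistic_law_def \<mu>_def ..
  have P_eq: "sample n \<theta>0 = \<P>"
    by (simp add: sample_def sample_law law_eq)
  define P where "P = law \<theta>0"
  interpret P: prob_space P
    unfolding P_def by (rule prob_space_law) simp
  interpret PP: prob_space \<P>
    unfolding P_eq[symmetric] by (rule prob_space_sample) simp
  have \<P>_PiM: "\<P> = PiM {1..n} (\<lambda>i. P)"
    by (simp add: sample_law P_def law_eq)

  \<comment> \<open>Prior, comparison Gaussian and their divergence\<close>
  define \<pi> where "\<pi> = (iso_gaussian 0 \<tau> :: (real ^ 'd) measure)"
  have \<pi>: "prob_space \<pi>" "sets \<pi> = sets borel"
    using prior_sd by (simp_all add: \<pi>_def prob_space_iso_gaussian)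
  \<comment> \<open>Standard deviation \<open>1 / n\<close> makes the mean of the averaged log-ratio
    of order \<open>K1 / n\<close> and its second moment of order \<open>K2 / n^2\<close>, while
    \<open>ln (\<tau> / \<sigma>)\<close> is half of \<open>ln (\<tau>^2 * n^2)\<close>.\<close>
  define \<sigma> where "\<sigma> = 1 / real n"
  have \<sigma>: "0 < \<sigma>" using n by (simp add: \<sigma>_def)
  define \<rho>0 where "\<rho>0 = iso_gaussian \<theta>0 \<sigma>"
  have \<rho>0: "prob_space \<rho>0" "sets \<rho>0 = sets borel"
    using \<sigma> by (simp_all add: \<rho>0_def prob_space_iso_gaussian)
  define \<kappa> where "\<kappa> = CARD('d) * (ln (\<tau> / \<sigma>) + \<sigma>\<^sup>2 / (2 * \<tau>\<^sup>2) - 1 / 2) + (norm \<theta>0)\<^sup>2 / (2 * \<tau>\<^sup>2)"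
  have KL: "KL \<rho>0 \<pi> = ereal \<kappa>"
    unfolding \<rho>0_def \<pi>_def \<kappa>_def using KL_iso_gaussian[OF \<sigma> prior_sd, of \<theta>0 0] by simp
  \<comment> \<open>\<open>\<kappa>\<close> is compared with \<open>n\<close> times the third entry
    of the maximum. The inequalities used are \<open>1 \<le> sqrt d\<close>,
    \<open>1 / (2 * n^2) \<le> 1 / n\<close>, and halving of the term in
    \<open>norm \<theta>0\<close>.\<close>
  have \<kappa>_le: "\<kappa> \<le> n * \<epsilon>n"
  proof -
    let ?d = "real CARD('d)"
    have d: "1 \<le> ?d" by (simp add: Suc_le_eq)
    have n': "1 \<le> real n" using n by simp
    have "\<tau>\<^sup>2 * n\<^sup>2 * 1 \<le> \<tau>\<^sup>2 * n\<^sup>2 * sqrt ?d"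
      using d by (intro mult_left_mono) auto
    then have "ln (\<tau>\<^sup>2 * n\<^sup>2) \<le> ln (\<tau>\<^sup>2 * n\<^sup>2 * sqrt ?d)"
      using prior_sd n by (subst ln_le_cancel_iff) auto
    moreover have "ln (\<tau>\<^sup>2 * n\<^sup>2) = 2 * ln (\<tau> / \<sigma>)"
      using prior_sd n by (simp add: \<sigma>_def ln_mult ln_realpow)
    ultimately have 1: "ln (\<tau> / \<sigma>) \<le> 1 / 2 * ln (\<tau>\<^sup>2 * n\<^sup>2 * sqrt ?d)"
      by simp
    have "1 * real n \<le> real n * real n"
      using n' by (intro mult_right_mono) auto
    then have 2: "\<sigma>\<^sup>2 / (2 * \<tau>\<^sup>2) \<le> 1 / (n * \<tau>\<^sup>2)"
      using prior_sd n' by (simp add: \<sigma>_def divide_simps power2_eq_square)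
    have 3: "(norm \<theta>0)\<^sup>2 / (2 * \<tau>\<^sup>2) \<le> (norm \<theta>0)\<^sup>2 / \<tau>\<^sup>2"
      using prior_sd by (intro divide_left_mono) auto
    have "\<kappa> \<le> ?d * (1 / 2 * ln (\<tau>\<^sup>2 * n\<^sup>2 * sqrt ?d) + 1 / (n * \<tau>\<^sup>2) - 1 / 2) + (norm \<theta>0)\<^sup>2 / \<tau>\<^sup>2"
      unfolding \<kappa>_def using 1 2 3 by (intro add_mono mult_left_mono) auto
    also have "\<dots> = n * (?d / n * (1 / 2 * ln (\<tau>\<^sup>2 * n\<^sup>2 * sqrt ?d) + 1 / (n * \<tau>\<^sup>2))
            + (norm \<theta>0)\<^sup>2 / (n * \<tau>\<^sup>2) - ?d / (2 * n))"
      using n' prior_sd by (simp add: distrib_left right_diff_distrib)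
    also have "\<dots> \<le> n * \<epsilon>n"
      using n' unfolding rate by (intro mult_left_mono) auto
    finally show ?thesis .
  qed

  \<comment> \<open>Moments of the averaged log-ratio of one observation\<close>
  define L where "L = mean_log_ratio \<rho>0 \<theta>0"
  have L_meas: "L \<in> borel_measurable P"
    unfolding L_def P_def measurable_cong_sets[OF sets_law refl] unfolding \<mu>_def
    by (rule mean_log_ratio_measurable[OF Q(2) \<rho>0])
  have space_P: "fst x \<in> {-1, 1}" if "x \<in> space P" for x
    using that unfolding P_def space_law unfolding \<mu>_def by (auto simp: space_pair_measure)
  have L_bound: "\<bar>L x\<bar> \<le> \<sigma> * norm (snd x)" if "x \<in> space P" for x
    using mean_log_ratio_iso_gaussian(2)[OF space_P[OF that] \<sigma>, of \<theta>0 "snd x"]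
    by (simp add: L_def \<rho>0_def)
  have snd_meas: "snd \<in> borel_measurable P"
    using measurable_snd[of "count_space {-1, 1::real}" Q]
    unfolding P_def measurable_cong_sets[OF sets_law refl] unfolding \<mu>_def measurable_cong_sets[OF refl Q(2)] .
  \<comment> \<open>\<open>K1\<close> and \<open>K2\<close> are expectations over coordinate 1 of
    the sample, which lies in the index set because 1 \<le> n; its marginal is
    \<open>P\<close>.\<close>
  have distr: "distr \<P> P (\<lambda>x. x 1) = P"
    unfolding \<P>_PiM using n by (intro distr_PiM_component P.prob_space_axioms) auto
  have comp_meas: "(\<lambda>x. x 1) \<in> measurable \<P> P"
    unfolding \<P>_PiM using n by (intro measurable_component_singleton) auto
  have moment: "integrable P f" "(\<integral>x. f x \<partial>P) = (\<integral>x. f (x 1) \<partial>\<P>)"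
    if "f \<in> borel_measurable P" "integrable \<P> (\<lambda>x. f (x 1))" for f :: "real \<times> (real ^ 'd) \<Rightarrow> real"
    using integrable_distr_eq[OF comp_meas that(1)] integral_distr[OF comp_meas that(1)] that(2)
    unfolding distr by simp_all
  have norm1: "integrable P (\<lambda>x. norm (snd x))" "(\<integral>x. norm (snd x) \<partial>P) = K1 / 2"
    using moment[of "\<lambda>x. norm (snd x)"] snd_meas K1_finite K1 by auto
  have norm2: "integrable P (\<lambda>x. (norm (snd x))\<^sup>2)" "(\<integral>x. (norm (snd x))\<^sup>2 \<partial>P) = K2 / 4"
    using moment[of "\<lambda>x. (norm (snd x))\<^sup>2"] snd_meas K2_finite K2 by auto
  have K_nonneg: "0 \<le> K1" "0 \<le> K2"
    unfolding K1 K2 by simp_all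
  \<comment> \<open>\<open>K1\<close> is twice the first and \<open>K2\<close> four times the second
    moment of the norm. The bounds on \<open>L\<close> thus give halves and quarters, which
    \<open>half\<close> relaxes to the entries of the maximum.\<close>
  have half: "u / 2 \<le> u" if "0 \<le> u" for u :: real
    using that by simp
  have L_int: "integrable P L"
    by (rule Bochner_Integration.integrable_bound[OF integrable_mult_right[OF norm1(1), of \<sigma>] L_meas])
      (use L_bound \<sigma> in \<open>auto intro!: AE_I2\<close>)
  have L_sq_bound: "(L x)\<^sup>2 \<le> \<sigma>\<^sup>2 * (norm (snd x))\<^sup>2" if "x \<in> space P" for x
    using power_mono[OF L_bound[OF that], of 2] by (simp add: power_mult_distrib)
  have L_sq_int: "integrable P (\<lambda>x. (L x)\<^sup>2)"
    by (rule Bochner_Integration.integrable_bound[OF integrable_mult_right[OF norm2(1), of "\<sigma>\<^sup>2"]])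
      (use L_sq_bound L_meas in \<open>auto intro!: AE_I2\<close>)
  have L_mean: "(\<integral>x. L x \<partial>P) \<le> \<epsilon>n"
  proof -
    have "(\<integral>x. L x \<partial>P) \<le> (\<integral>x. \<sigma> * norm (snd x) \<partial>P)"
      using L_bound by (intro integral_mono L_int integrable_mult_right norm1) (auto intro: abs_le_D1)
    also have "\<dots> = K1 / n / 2"
      by (simp add: norm1(2) \<sigma>_def)
    also have "\<dots> \<le> K1 / n"
      using K_nonneg by (intro half) simp
    also have "\<dots> \<le> \<epsilon>n"
      unfolding rate by simp
    finally show ?thesis .
  qed
  \<comment> \<open>This form makes \<open>n * \<epsilon>n\<close> the bound \<open>v\<close> of
    \<open>sum_PiM_upper_tail\<close>, so that \<open>s\<close> below is its deviation
    \<open>sqrt (v / \<eta>)\<close>.\<close>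
  have L_var: "n * (\<integral>x. (L x)\<^sup>2 \<partial>P) \<le> n * \<epsilon>n"
  proof (rule mult_left_mono)
    have "(\<integral>x. (L x)\<^sup>2 \<partial>P) \<le> (\<integral>x. \<sigma>\<^sup>2 * (norm (snd x))\<^sup>2 \<partial>P)"
      using L_sq_bound by (intro integral_mono L_sq_int integrable_mult_right norm2) auto
    also have "\<dots> = K2 / n\<^sup>2 / 2 / 2"
      by (simp add: norm2(2) \<sigma>_def power_divide)
    also have "\<dots> \<le> K2 / n\<^sup>2"
      using K_nonneg by (intro order_trans[OF half half]) simp_all
    also have "\<dots> \<le> \<epsilon>n"
      unfolding rate by simp
    finally show "(\<integral>x. (L x)\<^sup>2 \<partial>P) \<le> \<epsilon>n" .
  qed simp

  \<comment> \<open>The exceptional events of the Markov and Chebyshev bounds\<close>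
  define s where "s = sqrt (n * \<epsilon>n / \<eta>)"
  define B1 where "B1 = {x \<in> space \<P>. pac_moment \<pi> \<alpha> \<theta>0 n x > ennreal (1 / \<epsilon>)}"
  define B2 where "B2 = {x \<in> space \<P>. (\<Sum>i=1..n. L (x i)) > n * (\<integral>x. L x \<partial>P) + s}"
  have B1: "B1 \<in> sets \<P>" "measure \<P> B1 \<le> \<epsilon>"
    using pac_moment_tail[of \<theta>0 \<alpha> \<pi> \<epsilon> n] \<alpha> \<epsilon> \<pi> by (simp_all add: B1_def P_eq)
  have B2: "B2 \<in> sets \<P>" "measure \<P> B2 \<le> \<eta>"
    using sum_PiM_upper_tail[OF P.prob_space_axioms L_meas L_sq_int L_var \<eta>(1)]
    by (simp_all add: B2_def s_def \<P>_PiM)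
  \<comment> \<open>\<open>G\<close> is measurable, although the event of the theorem, defined
    through \<open>post_var\<close>, may fail to be.\<close>
  define G where "G = space \<P> - (B1 \<union> B2)"
  have "measure \<P> G = 1 - measure \<P> (B1 \<union> B2)"
    unfolding G_def using B1 B2 by (intro PP.prob_compl) auto
  moreover have "measure \<P> (B1 \<union> B2) \<le> \<epsilon> + \<eta>"
    using measure_Un_le[OF B1(1) B2(1)] B1(2) B2(2) by simp
  ultimately have G: "G \<in> sets \<P>" "1 - \<epsilon> - \<eta> \<le> measure \<P> G"
    using B1 B2 by (auto simp: G_def)

  \<comment> \<open>The risk bound off the exceptional events\<close>
  let ?A = "{x \<in> space \<P>. (\<integral>\<^sup>+\<theta>. renyi_div \<alpha> (logistic_law Q \<theta>) (logistic_law Q \<theta>0) \<partial>post_var x)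
      \<le> ennreal (((\<alpha> + 1) * \<epsilon>n + \<alpha> * sqrt (\<epsilon>n / (n * \<eta>)) + ln (1 / \<epsilon>) / n) / (1 - \<alpha>))}"
  have "G \<subseteq> ?A"
  proof
    fix x assume "x \<in> G"
    then have x: "x \<in> space \<P>" "pac_moment \<pi> \<alpha> \<theta>0 n x \<le> ennreal (1 / \<epsilon>)"
      "(\<Sum>i=1..n. L (x i)) \<le> n * (\<integral>x. L x \<partial>P) + s"
      by (auto simp: G_def B1_def B2_def)
    have x_i: "x i \<in> space P" if "i \<in> {1..n}" for i
      using x(1) that by (auto simp: \<P>_PiM space_PiM PiE_iff)
    have i_int: "integrable \<rho>0 (\<lambda>\<theta>. ln (logistic_prob \<theta>0 (x i) / logistic_prob \<theta> (x i)))" if "i \<in> {1..n}" for i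
      using mean_log_ratio_iso_gaussian(1)[OF space_P[OF x_i[OF that]] \<sigma>, of \<theta>0 "snd (x i)"]
      by (simp add: \<rho>0_def)
    have r_int: "integrable \<rho>0 (\<lambda>\<theta>. log_ratio logistic_prob n x \<theta> \<theta>0)"
      unfolding log_ratio_def by (intro Bochner_Integration.integrable_sum i_int)
    have r_eq: "(\<integral>\<theta>. log_ratio logistic_prob n x \<theta> \<theta>0 \<partial>\<rho>0) = (\<Sum>i=1..n. L (x i))"
      unfolding log_ratio_def L_def mean_log_ratio_def by (intro Bochner_Integration.integral_sum i_int)
    \<comment> \<open>\<open>is_arg_min\<close> only says that no competitor is strictly better;
      linearity of the order on \<open>ereal\<close> turns this into \<open>\<le>\<close> against
      \<open>\<rho>0\<close>, a member of the family.\<close>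
    have min: "post_var x \<in> \<F>"
      "KL (post_var x) (tempered_posterior logistic_prob \<pi> \<alpha> \<theta>0 n x) \<le>
        KL \<rho>0 (tempered_posterior logistic_prob \<pi> \<alpha> \<theta>0 n x)"
      using variational[OF x(1)] family_gaussian \<sigma>
      by (auto simp: is_arg_min_def \<pi>_def \<rho>0_def not_less)
    have \<rho>: "prob_space (post_var x)" "sets (post_var x) = sets borel"
      using min(1) family by (auto simp: space_prob_algebra)
    have "(\<integral>\<^sup>+\<theta>. renyi_div \<alpha> (logistic_law Q \<theta>) (logistic_law Q \<theta>0) \<partial>post_var x) \<le>
        ennreal ((\<alpha> * (\<Sum>i=1..n. L (x i)) + \<kappa> + ln (1 / \<epsilon>)) / (n * (1 - \<alpha>)))"
      using variational_renyi_bound[OF _ _ \<alpha> n \<epsilon>(1) \<pi> \<rho> \<rho>0 min(2) KL r_int x(2), of \<theta>0] x(1)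
      by (simp add: law_eq P_eq r_eq)
    also have "\<dots> \<le> ennreal (((\<alpha> + 1) * \<epsilon>n + \<alpha> * sqrt (\<epsilon>n / (n * \<eta>)) + ln (1 / \<epsilon>) / n) / (1 - \<alpha>))"
    proof (rule ennreal_leI)
      have "n * (\<integral>x. L x \<partial>P) \<le> n * \<epsilon>n"
        using L_mean by (intro mult_left_mono) auto
      then have L_le: "\<alpha> * (\<Sum>i=1..n. L (x i)) \<le> \<alpha> * (n * \<epsilon>n + s)"
        using x(3) \<alpha> by (intro mult_left_mono) auto
      have "(\<alpha> * (\<Sum>i=1..n. L (x i)) + \<kappa> + ln (1 / \<epsilon>)) / (n * (1 - \<alpha>)) \<le>
          (\<alpha> * (n * \<epsilon>n + s) + n * \<epsilon>n + ln (1 / \<epsilon>)) / (n * (1 - \<alpha>))"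
        using \<alpha> by (intro divide_right_mono add_mono L_le \<kappa>_le order_refl) auto
      \<comment> \<open>Taking \<open>n^2\<close> out of the root gives the deviation term of the
        claim after division by \<open>n\<close>.\<close>
      also have "s = n * sqrt (\<epsilon>n / (n * \<eta>))"
      proof -
        have "n * \<epsilon>n / \<eta> = (real n)\<^sup>2 * (\<epsilon>n / (n * \<eta>))"
          using n by (simp add: power2_eq_square)
        then show ?thesis
          by (simp only: s_def real_sqrt_mult) simp
      qed
      also have "(\<alpha> * (n * \<epsilon>n + n * sqrt (\<epsilon>n / (n * \<eta>))) + n * \<epsilon>n + ln (1 / \<epsilon>)) / (n * (1 - \<alpha>)) =
          ((\<alpha> + 1) * \<epsilon>n + \<alpha> * sqrt (\<epsilon>n / (n * \<eta>)) + ln (1 / \<epsilon>) / n) / (1 - \<alpha>)"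
      proof -
        have "\<alpha> * (n * \<epsilon>n + n * sqrt (\<epsilon>n / (n * \<eta>))) + n * \<epsilon>n + ln (1 / \<epsilon>) =
          n * ((\<alpha> + 1) * \<epsilon>n + \<alpha> * sqrt (\<epsilon>n / (n * \<eta>)) + ln (1 / \<epsilon>) / n)"
          using n by (simp add: algebra_simps)
        then show ?thesis
          using n by simp
      qed
      finally show "(\<alpha> * (\<Sum>i=1..n. L (x i)) + \<kappa> + ln (1 / \<epsilon>)) / (n * (1 - \<alpha>)) \<le>
          ((\<alpha> + 1) * \<epsilon>n + \<alpha> * sqrt (\<epsilon>n / (n * \<eta>)) + ln (1 / \<epsilon>) / n) / (1 - \<alpha>)" .
    qed
    finally show "x \<in> ?A"
      using x(1) by simp
  qed
  \<comment> \<open>\<open>G\<close> is one of the sets in the supremum. The reals are only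
    conditionally complete, hence the upper bound 1.\<close>
  then have "measure \<P> G \<le> inner_prob \<P> ?A"
    unfolding inner_prob_def using G(1)
    by (intro cSUP_upper) (auto intro!: bdd_aboveI[of _ 1])
  with G(2) show ?thesis by simp
qed

end
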